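(* Let $P\subset\mathbb{R}^n$ be an $n$-dimensional rational polytope and let $\mathrm{Q}(P,r)=\sum_{i=0}^n\mathrm{Q}_i(P,r)r^i$ be its rational Ehrhart quasi-polynomial. Then for each $i=0,\dots,n$, $\mathrm{Q}_i(P,\cdot)$ is a piecewise polynomial of degree $n-i$.
   Context: For a rational polytope $P$, let $\mathrm{G}_i(P,\cdot)$ be the unique periodic functions on $\mathbb{Z}_{\ge 0}$ with $\#(kP\cap\mathbb{Z}^n)=\sum_i\mathrm{G}_i(P,k)k^i$ for $k\in\mathbb{Z}_{\ge0}$ (Ehrhart quasi-polynomial). The rational Ehrhart coefficients are $\mathrm{Q}_i(P,a/b):=b^i\mathrm{G}_i(\tfrac1bP,a)$ for $a\in\mathbb{Z}_{\ge0}$, $b\in\mathbb{Z}_{>0}$; they are well defined, periodic, and $\#(rP\cap\mathbb{Z}^n)=\sum_i\mathrm{Q}_i(P,r)r^i$ for $r\in\mathbb{Q}_{\ge 0}$. A function $f:\mathbb{Q}_{\ge0}\to\mathbb{Q}$ is a piecewise polynomial of degree $m$ if there is a discrete set of breakpoints in $\mathbb{Q}_{\ge 0}$ (finitely many in each bounded interval) such that on the rational points of each open interval between consecutive breakpoints $f$ coincides with a polynomial of degree $m$. *)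

theory Defs
  imports "HOL-Analysis.Analysis" "HOL-Computational_Algebra.Polynomial"
begin

definition rational_polytope :: "(real ^ 'n) set \<Rightarrow> bool" where
  "rational_polytope P \<longleftrightarrow>
     (\<exists>V. finite V \<and> (\<forall>v\<in>V. \<forall>i. v $ i \<in> \<rat>) \<and> P = convex hull V)"

definition lattice_points :: "(real ^ 'n) set \<Rightarrow> (real ^ 'n) set" where
  "lattice_points S = {x \<in> S. \<forall>i. x $ i \<in> \<int>}"

abbreviation dilate :: "real \<Rightarrow> (real ^ 'n) set \<Rightarrow> (real ^ 'n) set" where
  "dilate c S \<equiv> (\<lambda>x. c *\<^sub>R x) ` S"

text \<open>Coefficients with index above the ambient dimension are set to zero, so that
  the whole family, as a total function, is determined uniquely.\<close>

definition is_ehrhart_coeffs :: "(real ^ 'n) set \<Rightarrow> (nat \<Rightarrow> nat \<Rightarrow> rat) \<Rightarrow> bool" where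
  "is_ehrhart_coeffs P G \<longleftrightarrow>
     (\<forall>i\<le>CARD('n). \<exists>d>0. \<forall>k. G i (k + d) = G i k) \<and>
     (\<forall>i>CARD('n). \<forall>k. G i k = 0) \<and>
     (\<forall>k. of_nat (card (lattice_points (dilate (real k) P))) =
            (\<Sum>i\<le>CARD('n). G i k * of_nat k ^ i))"

definition ehrhart_coeff :: "(real ^ 'n) set \<Rightarrow> nat \<Rightarrow> nat \<Rightarrow> rat" where
  "ehrhart_coeff P = (THE G. is_ehrhart_coeffs P G)"

text \<open>The description ranges over all representations \<open>r = a / b\<close>, reduced or not: the
  value does not depend on the representation. It is meaningful only for \<open>r \<ge> 0\<close>.\<close>

definition rational_ehrhart_coeff :: "(real ^ 'n) set \<Rightarrow> nat \<Rightarrow> rat \<Rightarrow> rat" where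
  "rational_ehrhart_coeff P i r =
     (THE q. \<forall>a b. b > 0 \<and> r = of_nat a / of_nat b \<longrightarrow>
        q = of_nat b ^ i * ehrhart_coeff (dilate (1 / real b) P) i a)"

text \<open>Functions on the nonnegative rationals; values at negative arguments are ignored.
  Quantifying over all open intervals of nonnegative rationals that avoid the breakpoints,
  instead of only those bounded by two consecutive breakpoints, includes the stretches before
  the first and after the last breakpoint; otherwise an empty set of breakpoints would make
  the condition vacuous. The degree is exact.\<close>

definition piecewise_polynomial :: "nat \<Rightarrow> (rat \<Rightarrow> rat) \<Rightarrow> bool" where
  "piecewise_polynomial m f \<longleftrightarrow>
     (\<exists>B \<subseteq> {0..}. (\<forall>M. finite (B \<inter> {..M})) \<and>
        (\<forall>a b. 0 \<le> a \<and> a < b \<and> {a<..<b} \<inter> B = {} \<longrightarrow>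
           (\<exists>p. degree p = m \<and> (\<forall>x\<in>{a<..<b}. f x = poly p x))))"

end

(* Linke's argument. The count of lattice points in (r + lD)P, as a function of l, is a polynomial
   whose coefficients are read off from Q_0(P,r), ..., Q_n(P,r), by Ehrhart's theorem. If no
   facet value r beta crosses an integer between r and s, then (r + lD)P and (s + lD)P have the
   same lattice points for a suitable period D and all l, hence
     sum_j Q_j(P,r) x^j = sum_j Q_j(P,s) (x + s - r)^j,
   which gives Q_i(P,r) = sum_(j >= i) Q_j(P,s) (j choose i) (s - r)^(j - i). As a polynomial in r
   it has degree exactly n - i, because Q_n(P,s) is nonzero when P contains a box.

   Ehrhart's theorem itself goes by induction on the dimension, for all shifted lattices Z^n + t
   at once. Moving a vertex to the origin changes only t, and t depends only on the residue of the
   dilation factor. If 0 lies in P, the dilates of P grow by dilates of the facets missing 0, which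
   are counted by inclusion-exclusion over faces of smaller dimension. Since the count is a partial
   sum starting from 0P, the quasi-polynomial also has the right value at 0. *)

theory Submission
  imports Defs
begin

section \<open>Polynomials\<close>

text \<open>Stated for ordered fields so that it applies to \<open>rat\<close>. If \<open>p\<close>
  stays above \<open>c > 0\<close>, then \<open>a + x * poly p x\<close> stays above
  \<open>c\<close> once \<open>x\<close> is nonnegative and \<open>x * c\<close> is at least
  \<open>c - a\<close>.\<close>

lemma poly_eventually_bounded_below:
  fixes p :: "'a::linordered_field poly"
  assumes "lead_coeff p > 0"
  shows "\<exists>c>0. \<exists>N. \<forall>x\<ge>N. c \<le> poly p x"
  using assms
proof (induction p)
  case 0
  then show ?case by simp
next
  case (pCons a p)
  show ?case
  proof (cases "p = 0")
    case True
    with pCons.prems show ?thesis by auto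
  next
    case False
    then obtain c N where c: "c > 0" "\<And>x. x \<ge> N \<Longrightarrow> c \<le> poly p x"
      using pCons by auto
    have "c \<le> poly (pCons a p) x" if "x \<ge> max N (max 0 ((c - a) / c))" for x
    proof -
      have "c - a \<le> x * c" using that c(1) by (simp add: pos_divide_le_eq)
      also have "\<dots> \<le> x * poly p x" using that c(2) by (intro mult_left_mono) auto
      finally show ?thesis by simp
    qed
    with c(1) show ?thesis by blast
  qed
qed

text \<open>Turns inequalities between counts into statements on degrees and leading coefficients:
  it is applied to the difference of a polynomial count and a polynomial bound.\<close>

lemma lead_coeff_nonneg:
  fixes p :: "rat poly"
  assumes "\<And>l. poly p (of_nat l) \<ge> 0"
  shows "lead_coeff p \<ge> 0"
proof (rule ccontr)
  assume "\<not> lead_coeff p \<ge> 0"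
  then have "lead_coeff (- p) > 0" by simp
  then obtain c N where "c > 0" and c: "\<And>x. x \<ge> N \<Longrightarrow> c \<le> poly (- p) x"
    using poly_eventually_bounded_below by blast
  obtain l where "of_nat l \<ge> N" by (meson real_arch_simple)
  from c[OF this] \<open>c > 0\<close> assms[of l] show False by simp
qed

text \<open>A nonzero difference has finitely many roots, while a progression with nonzero step has
  infinitely many members.\<close>

lemma poly_eqI_of_nat:
  fixes p q :: "'a::field_char_0 poly"
  assumes "e \<noteq> 0" and "\<And>l. poly p (r + of_nat l * e) = poly q (r + of_nat l * e)"
  shows "p = q"
proof (rule ccontr)
  assume "p \<noteq> q"
  then have "finite {x. poly (p - q) x = 0}" by (intro poly_roots_finite) simp
  moreover have "range (\<lambda>l::nat. r + of_nat l * e) \<subseteq> {x. poly (p - q) x = 0}"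
    using assms(2) by auto
  moreover have "inj (\<lambda>l::nat. r + of_nat l * e)"
    using assms(1) by (auto simp: inj_on_def)
  ultimately show False
    using finite_subset finite_imageD infinite_UNIV_nat by blast
qed

section \<open>Coefficient lists and power sums\<close>

lemma poly_monom_sum:
  fixes c :: "nat \<Rightarrow> 'a::comm_semiring_1"
  shows "poly (\<Sum>i\<le>n. monom (c i) i) x = (\<Sum>i\<le>n. c i * x ^ i)"
  by (simp add: poly_sum poly_monom)

lemma poly_sum_upto_degree:
  fixes x :: "'a::comm_semiring_1"
  assumes "degree p \<le> n"
  shows "poly p x = (\<Sum>i\<le>n. coeff p i * x ^ i)"
  by (metis assms poly_as_sum_of_monoms' poly_monom_sum)

lemma coeff_monom_sum: "coeff (\<Sum>i\<le>n. monom (c i) i) k = (if k \<le> n then c k else 0)"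
  by (simp add: coeff_sum coeff_monom)

text \<open>Telescoping (i+1)^(m+1) - i^(m+1) and expanding binomially expresses l^(m+1) through the
  power sums with exponents up to m; solving for exponent m leaves only smaller ones.\<close>

lemma power_sum_poly: "\<exists>q :: rat poly. \<forall>l. (\<Sum>i<l. of_nat i ^ m) = poly q (of_nat l)"
proof (induction m rule: less_induct)
  case (less m)
  then obtain Q :: "nat \<Rightarrow> rat poly"
    where Q: "\<And>j l. j < m \<Longrightarrow> (\<Sum>i<l. of_nat i ^ j) = poly (Q j) (of_nat l)"
    by metis
  let ?q = "smult (1 / of_nat (Suc m))
      (monom 1 (Suc m) - (\<Sum>j<m. smult (of_nat (Suc m choose j)) (Q j)))"
  have "(\<Sum>i<l. of_nat i ^ m) = poly ?q (of_nat l)" for l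
  proof -
    have "(of_nat l :: rat) ^ Suc m = (\<Sum>i<l. of_nat (Suc i) ^ Suc m - of_nat i ^ Suc m)"
      by (subst sum_lessThan_telescope) simp
    also have "\<dots> = (\<Sum>i<l. \<Sum>j\<le>m. of_nat (Suc m choose j) * of_nat i ^ j)"
    proof (rule sum.cong[OF refl])
      fix i
      have "(of_nat (Suc i) :: rat) ^ Suc m = (of_nat i + 1) ^ Suc m" by (simp add: add.commute)
      also have "\<dots> = (\<Sum>j\<le>Suc m. of_nat (Suc m choose j) * of_nat i ^ j)"
        by (subst binomial_ring) simp
      finally show "(of_nat (Suc i) :: rat) ^ Suc m - of_nat i ^ Suc m
          = (\<Sum>j\<le>m. of_nat (Suc m choose j) * of_nat i ^ j)" by simp
    qed
    also have "\<dots> = (\<Sum>j\<le>m. of_nat (Suc m choose j) * (\<Sum>i<l. of_nat i ^ j))"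
      by (subst sum.swap) (simp add: sum_distrib_left)
    also have "\<dots> = (\<Sum>j<m. of_nat (Suc m choose j) * (\<Sum>i<l. of_nat i ^ j))
        + of_nat (Suc m) * (\<Sum>i<l. of_nat i ^ m)"
      by (simp add: lessThan_Suc_atMost[symmetric] del: of_nat_Suc)
    also have "(\<Sum>j<m. of_nat (Suc m choose j) * (\<Sum>i<l. of_nat i ^ j :: rat))
        = poly (\<Sum>j<m. smult (of_nat (Suc m choose j)) (Q j)) (of_nat l)"
      by (simp add: poly_sum Q)
    finally show ?thesis
      by (simp add: poly_monom field_simps del: of_nat_Suc)
  qed
  then show ?case by blast
qed

lemma sum_poly:
  fixes p :: "rat poly"
  shows "\<exists>q. \<forall>l. (\<Sum>i<l. poly p (of_nat i)) = poly q (of_nat l)"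
proof -
  obtain Q :: "nat \<Rightarrow> rat poly" where Q: "\<And>j l. (\<Sum>i<l. of_nat i ^ j) = poly (Q j) (of_nat l)"
    using power_sum_poly by metis
  have "(\<Sum>i<l. poly p (of_nat i)) = poly (\<Sum>j\<le>degree p. smult (coeff p j) (Q j)) (of_nat l)" for l
  proof -
    have "(\<Sum>i<l. poly p (of_nat i)) = (\<Sum>j\<le>degree p. coeff p j * (\<Sum>i<l. of_nat i ^ j))"
      by (simp add: poly_altdef sum_distrib_left sum.swap[of _ "{..<l}"])
    then show ?thesis by (simp add: poly_sum Q)
  qed
  then show ?thesis by blast
qed

section \<open>Quasi-polynomials\<close>

text \<open>The polynomial is in the number \<open>l\<close> of periods, not in the argument, and is
  valid from \<open>l = 0\<close> on, so the value at 0 is covered. The degree stays open; the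
  growth of the count bounds it later.\<close>

definition quasi_polynomial :: "nat \<Rightarrow> (nat \<Rightarrow> rat) \<Rightarrow> bool" where
  "quasi_polynomial d f \<longleftrightarrow> d > 0 \<and> (\<forall>j. \<exists>p. \<forall>l. f (j + l * d) = poly p (of_nat l))"

lemma quasi_polynomial_dvd:
  assumes "quasi_polynomial d f" "d dvd e" "e > 0"
  shows "quasi_polynomial e f"
  unfolding quasi_polynomial_def
proof (intro conjI allI)
  fix j
  from assms(2) obtain m where m: "e = d * m" by blast
  obtain p where p: "\<And>l. f (j + l * d) = poly p (of_nat l)"
    using assms(1) unfolding quasi_polynomial_def by metis
  have "f (j + l * e) = poly (pcompose p [:0, of_nat m:]) (of_nat l)" for l
    using p[of "l * m"] by (simp add: m poly_pcompose mult_ac)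
  then show "\<exists>p. \<forall>l. f (j + l * e) = poly p (of_nat l)" by blast
qed (use assms in auto)

lemma quasi_polynomial_const: "quasi_polynomial 1 (\<lambda>_. c)"
  unfolding quasi_polynomial_def by (auto intro!: exI[of _ "[:c:]"])

lemma quasi_polynomial_lincomb:
  assumes f: "quasi_polynomial d f" and g: "quasi_polynomial e g"
  shows "quasi_polynomial (d * e) (\<lambda>k. f k + c * g k)"
proof -
  have pos: "d * e > 0" using f g unfolding quasi_polynomial_def by simp
  have f': "quasi_polynomial (d * e) f" and g': "quasi_polynomial (d * e) g"
    using quasi_polynomial_dvd[OF f _ pos] quasi_polynomial_dvd[OF g _ pos] by auto
  have "\<exists>r. \<forall>l. f (j + l * (d * e)) + c * g (j + l * (d * e)) = poly r (of_nat l)" for j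
  proof -
    obtain p q where "\<And>l. f (j + l * (d * e)) = poly p (of_nat l)"
      and "\<And>l. g (j + l * (d * e)) = poly q (of_nat l)"
      using f' g' unfolding quasi_polynomial_def by metis
    then have "f (j + l * (d * e)) + c * g (j + l * (d * e)) = poly (p + smult c q) (of_nat l)" for l
      by simp
    then show ?thesis by blast
  qed
  with pos show ?thesis unfolding quasi_polynomial_def by blast
qed

text \<open>After the first \<open>j\<close> terms the sum splits into \<open>l\<close> blocks of
  length \<open>d\<close>. A block sum is a polynomial in the number of the block, so
  \<open>sum_poly\<close> applies.\<close>

lemma quasi_polynomial_partial_sum:
  assumes "quasi_polynomial d g"
  shows "quasi_polynomial d (\<lambda>m. \<Sum>i<m. g i)"
  unfolding quasi_polynomial_def
proof (intro conjI allI)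
  show "d > 0" using assms unfolding quasi_polynomial_def by simp
  fix j
  obtain p where p: "\<And>i l. g (i + l * d) = poly (p i) (of_nat l)"
    using assms unfolding quasi_polynomial_def by metis
  obtain q where q: "\<And>l. (\<Sum>l'<l. poly (\<Sum>i<d. p (j + i)) (of_nat l')) = poly q (of_nat l)"
    using sum_poly by metis
  have split: "(\<Sum>i<m + n. g i) = (\<Sum>i<m. g i) + (\<Sum>i<n. g (m + i))" for m n
    by (induction n) (simp_all add: add_ac)
  have block: "(\<Sum>i<j + l * d. g i) = (\<Sum>i<j. g i) + (\<Sum>l'<l. \<Sum>i<d. g (j + i + l' * d))" for l
  proof (induction l)
    case (Suc l)
    have "(\<Sum>i<j + Suc l * d. g i) = (\<Sum>i<(j + l * d) + d. g i)" by (simp add: algebra_simps)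
    also have "\<dots> = (\<Sum>i<j + l * d. g i) + (\<Sum>i<d. g (j + i + l * d))"
      by (subst split) (simp add: add_ac)
    finally show ?case using Suc by simp
  qed simp
  have "(\<Sum>i<j + l * d. g i) = poly ([:\<Sum>i<j. g i:] + q) (of_nat l)" for l
    by (simp add: block q[symmetric] poly_sum p)
  then show "\<exists>q. \<forall>l. (\<Sum>i<j + l * d. g i) = poly q (of_nat l)" by blast
qed

section \<open>Changes of argument, residue classes and inclusion-exclusion\<close>

lemma quasi_polynomial_mult_arg:
  assumes "quasi_polynomial d f"
  shows "quasi_polynomial d (\<lambda>k. f (b * k))"
  unfolding quasi_polynomial_def
proof (intro conjI allI)
  show "d > 0" using assms unfolding quasi_polynomial_def by simp
  fix j
  obtain p where p: "\<And>l. f (b * j + l * d) = poly p (of_nat l)"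
    using assms unfolding quasi_polynomial_def by metis
  have "f (b * (j + l * d)) = poly (pcompose p [:0, of_nat b:]) (of_nat l)" for l
    using p[of "b * l"] by (simp add: poly_pcompose algebra_simps)
  then show "\<exists>q. \<forall>l. f (b * (j + l * d)) = poly q (of_nat l)" by blast
qed

lemma quasi_polynomial_Suc_arg:
  assumes "quasi_polynomial d f"
  shows "quasi_polynomial d (\<lambda>k. f (Suc k))"
  using assms unfolding quasi_polynomial_def by (metis add_Suc)

text \<open>Meant for the translation of a vertex to the origin: the count that replaces the
  original one depends on the residue of the dilation factor.\<close>

lemma quasi_polynomial_residues:
  assumes "d > 0" and "\<And>j. j < d \<Longrightarrow> \<exists>e g. quasi_polynomial e g \<and> (\<forall>l. f (j + l * d) = g (j + l * d))"
  shows "\<exists>e. quasi_polynomial e f"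
proof -
  obtain e g where eg: "\<And>j. j < d \<Longrightarrow> quasi_polynomial (e j) (g j)"
    and fg: "\<And>j l. j < d \<Longrightarrow> f (j + l * d) = g j (j + l * d)"
    using assms(2) by metis
  \<comment> \<open>A multiple of \<open>d\<close>, so that steps of length \<open>E\<close> stay in
    one residue class, and of every period \<open>e j\<close>.\<close>
  define E where "E = d * (\<Prod>j<d. e j)"
  have pos: "E > 0" using eg assms(1) unfolding quasi_polynomial_def by (auto simp: E_def)
  have "\<exists>p. \<forall>l. f (j + l * E) = poly p (of_nat l)" for j
  proof -
    define i where "i = j mod d"
    have i: "i < d" using assms(1) by (simp add: i_def)
    then have "e i dvd E" by (auto simp: E_def intro: dvd_mult dvd_prodI)
    with eg[OF i] have "quasi_polynomial E (g i)" using pos by (rule quasi_polynomial_dvd)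
    then obtain p where p: "\<And>l. g i (j + l * E) = poly p (of_nat l)"
      unfolding quasi_polynomial_def by metis
    have "f (j + l * E) = g i (j + l * E)" for l
    proof -
      have "(j + l * E) mod d = i" by (simp add: i_def E_def mod_simps mult.left_commute[of l])
      then have "j + l * E = i + ((j + l * E) div d) * d" by (metis add.commute div_mult_mod_eq)
      with fg[OF i, of "(j + l * E) div d"] show ?thesis by metis
    qed
    with p show ?thesis by auto
  qed
  with pos show ?thesis unfolding quasi_polynomial_def by blast
qed

text \<open>Inclusion-exclusion one set at a time. The induction is over all families
  \<open>X\<close>, because the overlap of the new set with the old union is the union of the family
  \<open>X x k \<inter> X a k\<close>.\<close>

lemma quasi_polynomial_card_Union:
  fixes X :: "'b \<Rightarrow> nat \<Rightarrow> 'c set"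
  assumes "finite I" and "\<And>a k. a \<in> I \<Longrightarrow> finite (X a k)"
    and "\<And>S. S \<subseteq> I \<Longrightarrow> S \<noteq> {} \<Longrightarrow> \<exists>d. quasi_polynomial d (\<lambda>k. of_nat (card (\<Inter>a\<in>S. X a k)))"
  shows "\<exists>d. quasi_polynomial d (\<lambda>k. of_nat (card (\<Union>a\<in>I. X a k)))"
  using assms
proof (induction I arbitrary: X rule: finite_induct)
  case empty
  then show ?case using quasi_polynomial_const[of 0] by auto
next
  case (insert x I)
  let ?U = "\<lambda>k. \<Union>a\<in>I. X a k" and ?V = "\<lambda>k. \<Union>a\<in>I. X x k \<inter> X a k"
  have "\<exists>d. quasi_polynomial d (\<lambda>k. of_nat (card (?U k)))"
    using insert.prems by (intro insert.IH) auto
  moreover have "\<exists>d. quasi_polynomial d (\<lambda>k. of_nat (card (?V k)))"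
  proof (rule insert.IH)
    fix S assume S: "S \<subseteq> I" "S \<noteq> {}"
    have "(\<Inter>a\<in>S. X x k \<inter> X a k) = (\<Inter>a\<in>insert x S. X a k)" for k using S(2) by auto
    with insert.prems(2)[of "insert x S"] S
    show "\<exists>d. quasi_polynomial d (\<lambda>k. of_nat (card (\<Inter>a\<in>S. X x k \<inter> X a k)))" by auto
  qed (use insert.prems in auto)
  moreover have "\<exists>d. quasi_polynomial d (\<lambda>k. of_nat (card (X x k)))"
    using insert.prems(2)[of "{x}"] by auto
  ultimately obtain d1 d2 d3 where
    "quasi_polynomial d1 (\<lambda>k. of_nat (card (X x k)))"
    "quasi_polynomial d2 (\<lambda>k. of_nat (card (?U k)))"
    "quasi_polynomial d3 (\<lambda>k. of_nat (card (?V k)))" by blast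
  note quasi_polynomial_lincomb[OF quasi_polynomial_lincomb[OF this(1,2), of 1] this(3), of "-1"]
  moreover have "(of_nat (card (\<Union>a\<in>insert x I. X a k)) :: rat)
      = of_nat (card (X x k)) + 1 * of_nat (card (?U k)) + (-1) * of_nat (card (?V k))" for k
  proof -
    have "card (X x k) + card (?U k) = card (X x k \<union> ?U k) + card (X x k \<inter> ?U k)"
      using insert by (intro card_Un_Int) auto
    moreover have "X x k \<inter> ?U k = ?V k" "X x k \<union> ?U k = (\<Union>a\<in>insert x I. X a k)" by auto
    ultimately have "of_nat (card (X x k) + card (?U k))
        = (of_nat (card (\<Union>a\<in>insert x I. X a k) + card (?V k)) :: rat)" by metis
    then show ?thesis by (simp add: algebra_simps)
  qed
  ultimately show ?case by auto
qed

section \<open>Rational polyhedra\<close>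

text \<open>Formulated for Euclidean spaces so that it also covers the homogenised points
  \<open>(v, 1)\<close> in a product space.\<close>

definition rational_vector :: "'a::euclidean_space \<Rightarrow> bool" where
  "rational_vector x \<longleftrightarrow> (\<forall>b\<in>Basis. x \<bullet> b \<in> \<rat>)"

lemma rational_vector_inner:
  assumes "rational_vector x" "rational_vector y"
  shows "x \<bullet> y \<in> \<rat>"
  by (subst euclidean_inner) (use assms in \<open>auto simp: rational_vector_def intro!: Rats_sum\<close>)

lemma rational_vector_scaleR: "c \<in> \<rat> \<Longrightarrow> rational_vector x \<Longrightarrow> rational_vector (c *\<^sub>R x)"
  by (simp add: rational_vector_def)

lemma rational_vector_diff: "rational_vector x \<Longrightarrow> rational_vector y \<Longrightarrow> rational_vector (x - y)"
  by (simp add: rational_vector_def inner_diff_left)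

lemma rational_vector_Basis: "b \<in> Basis \<Longrightarrow> rational_vector b"
  by (auto simp: rational_vector_def inner_Basis)

lemma rational_vector_uminus: "rational_vector x \<Longrightarrow> rational_vector (- x)"
  by (simp add: rational_vector_def)

lemma rational_vector_vec: "rational_vector (x :: real ^ 'n) \<longleftrightarrow> (\<forall>i. x $ i \<in> \<rat>)"
  by (auto simp: rational_vector_def Basis_vec_def inner_axis)

lemma rational_vector_Pair: "rational_vector (x, y) \<longleftrightarrow> rational_vector x \<and> rational_vector y"
  by (auto simp: rational_vector_def Basis_prod_def ball_Un)

lemma rational_vector_real: "rational_vector (x :: real) \<longleftrightarrow> x \<in> \<rat>"
  by (simp add: rational_vector_def)

text \<open>A constraint with \<open>a \<bullet> v > 0\<close> bounds \<open>t\<close> from below,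
  one with \<open>a \<bullet> v < 0\<close> from above, and \<open>t \<ge> 0\<close> is the lower
  bound 0. Some \<open>t\<close> exists iff no lower bound exceeds an upper one; comparing with the
  lower bound 0 gives the first condition for \<open>a \<bullet> v < 0\<close>.\<close>

lemma fourier_motzkin:
  fixes v :: "'a::real_inner"
  assumes "finite A"
  shows "(\<exists>t\<ge>0. \<forall>a\<in>A. a \<bullet> (x - t *\<^sub>R v) \<le> 0) \<longleftrightarrow>
    (\<forall>a\<in>A. a \<bullet> v \<le> 0 \<longrightarrow> a \<bullet> x \<le> 0) \<and>
    (\<forall>a\<in>A. \<forall>a'\<in>A. a \<bullet> v > 0 \<longrightarrow> a' \<bullet> v < 0 \<longrightarrow> ((a \<bullet> v) *\<^sub>R a' - (a' \<bullet> v) *\<^sub>R a) \<bullet> x \<le> 0)"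
    (is "?L \<longleftrightarrow> ?R")
proof
  assume ?L
  then obtain t where t: "t \<ge> 0" and tA: "\<And>a. a \<in> A \<Longrightarrow> a \<bullet> x \<le> t * (a \<bullet> v)"
    by (auto simp: inner_diff_right)
  show ?R
  proof (intro conjI ballI impI)
    fix a assume "a \<in> A" "a \<bullet> v \<le> 0"
    then show "a \<bullet> x \<le> 0" using tA[of a] t mult_nonneg_nonpos[of t "a \<bullet> v"] by linarith
  next
    fix a a' assume a: "a \<in> A" "a' \<in> A" "a \<bullet> v > 0" "a' \<bullet> v < 0"
    have "(a \<bullet> v) * (a' \<bullet> x) \<le> (a \<bullet> v) * (t * (a' \<bullet> v))"
      using a tA by (intro mult_left_mono) auto
    moreover have "(- (a' \<bullet> v)) * (a \<bullet> x) \<le> (- (a' \<bullet> v)) * (t * (a \<bullet> v))"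
      using a tA by (intro mult_left_mono) auto
    ultimately show "((a \<bullet> v) *\<^sub>R a' - (a' \<bullet> v) *\<^sub>R a) \<bullet> x \<le> 0"
      by (simp add: inner_diff_left algebra_simps)
  qed
next
  assume R: ?R
  \<comment> \<open>The lower bounds for \<open>t\<close>; the largest of them is the
    witness.\<close>
  define T where "T = insert 0 ((\<lambda>a. (a \<bullet> x) / (a \<bullet> v)) ` {a \<in> A. a \<bullet> v > 0})"
  have T: "finite T" "T \<noteq> {}" using assms by (auto simp: T_def)
  define t where "t = Max T"
  have t0: "t \<ge> 0" using T by (auto simp: t_def T_def)
  have "a \<bullet> x \<le> t * (a \<bullet> v)" if a: "a \<in> A" for a
  proof -
    consider "a \<bullet> v > 0" | "a \<bullet> v = 0" | "a \<bullet> v < 0" by linarith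
    then show ?thesis
    proof cases
      case 1
      then have "(a \<bullet> x) / (a \<bullet> v) \<le> t" using T a unfolding t_def by (intro Max_ge) (auto simp: T_def)
      with 1 show ?thesis by (simp add: pos_divide_le_eq)
    next
      case 2
      with R a show ?thesis by auto
    next
      case 3
      have "t \<in> T" using T by (simp add: t_def)
      then consider "t = 0" | b where "b \<in> A" "b \<bullet> v > 0" "t = (b \<bullet> x) / (b \<bullet> v)"
        by (auto simp: T_def)
      then show ?thesis
      proof cases
        case 1
        with R a 3 show ?thesis by auto
      next
        case (2 b)
        with R a 3 have "(b \<bullet> v) * (a \<bullet> x) \<le> (b \<bullet> x) * (a \<bullet> v)"
          by (auto simp: inner_diff_left algebra_simps)
        then have "a \<bullet> x \<le> (b \<bullet> x) * (a \<bullet> v) / (b \<bullet> v)"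
          using 2(2) by (simp add: pos_le_divide_eq mult.commute)
        with 2(3) show ?thesis by simp
      qed
    qed
  qed
  with t0 show ?L by (auto simp: inner_diff_right)
qed

text \<open>Induction on the number of generators; adding a generator \<open>v\<close> eliminates the variable
  \<open>t\<close> from \<open>x - t v \<in> C\<close>.\<close>

lemma rational_cone_halfspaces:
  fixes V :: "'a::euclidean_space set"
  assumes "finite V" "\<And>v. v \<in> V \<Longrightarrow> rational_vector v"
  shows "\<exists>A. finite A \<and> (\<forall>a\<in>A. rational_vector a) \<and>
    (\<forall>x. (\<exists>c. (\<forall>v\<in>V. 0 \<le> c v) \<and> x = (\<Sum>v\<in>V. c v *\<^sub>R v)) \<longleftrightarrow> (\<forall>a\<in>A. a \<bullet> x \<le> 0))"
  using assms
proof (induction V rule: finite_induct)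
  case empty
  \<comment> \<open>Without generators the cone is the origin, cut out by the basis vectors and
    their negatives.\<close>
  have "x = 0 \<longleftrightarrow> (\<forall>a\<in>Basis \<union> uminus ` Basis. a \<bullet> x \<le> 0)" for x :: 'a
  proof
    assume *: "\<forall>a\<in>Basis \<union> uminus ` Basis. a \<bullet> x \<le> 0"
    have "x \<bullet> b = 0" if "b \<in> Basis" for b
    proof -
      from that have "b \<bullet> x \<le> 0" "(- b) \<bullet> x \<le> 0" using * by blast+
      then show ?thesis by (simp add: inner_commute)
    qed
    then show "x = 0" using euclidean_all_zero_iff by blast
  qed simp
  then show ?case
    by (intro exI[of _ "Basis \<union> uminus ` Basis"])
       (auto intro: rational_vector_Basis rational_vector_uminus)
next
  case (insert v V)
  then have "\<And>v. v \<in> V \<Longrightarrow> rational_vector v" by simp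
  from insert.IH[OF this] obtain A where A: "finite A" "\<And>a. a \<in> A \<Longrightarrow> rational_vector a"
    and cone: "\<And>x. (\<exists>c. (\<forall>v\<in>V. 0 \<le> c v) \<and> x = (\<Sum>v\<in>V. c v *\<^sub>R v)) \<longleftrightarrow> (\<forall>a\<in>A. a \<bullet> x \<le> 0)"
    by blast
  \<comment> \<open>The constraints that \<open>fourier_motzkin\<close> produces from
    \<open>A\<close>. They are rational because the multipliers are inner products of rational
    vectors.\<close>
  define B where "B = {a \<in> A. a \<bullet> v \<le> 0} \<union>
      (\<lambda>(a, a'). (a \<bullet> v) *\<^sub>R a' - (a' \<bullet> v) *\<^sub>R a) ` {(a, a') \<in> A \<times> A. a \<bullet> v > 0 \<and> a' \<bullet> v < 0}"
  have "finite B" unfolding B_def using A(1)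
    by (intro finite_UnI finite_imageI finite_subset[OF _ finite_cartesian_product[OF A(1) A(1)]]) auto
  moreover have "rational_vector b" if "b \<in> B" for b
    using that A(2) insert.prems unfolding B_def
    by (auto intro!: rational_vector_diff rational_vector_scaleR rational_vector_inner)
  moreover have "(\<exists>c. (\<forall>u\<in>insert v V. 0 \<le> c u) \<and> x = (\<Sum>u\<in>insert v V. c u *\<^sub>R u)) \<longleftrightarrow>
      (\<forall>a\<in>B. a \<bullet> x \<le> 0)" for x
  proof -
    have "(\<exists>c. (\<forall>u\<in>insert v V. 0 \<le> c u) \<and> x = (\<Sum>u\<in>insert v V. c u *\<^sub>R u)) \<longleftrightarrow>
        (\<exists>t\<ge>0. \<exists>c. (\<forall>u\<in>V. 0 \<le> c u) \<and> x - t *\<^sub>R v = (\<Sum>u\<in>V. c u *\<^sub>R u))"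
    proof safe
      fix c assume c: "\<forall>u\<in>insert v V. 0 \<le> c u" "x = (\<Sum>u\<in>insert v V. c u *\<^sub>R u)"
      with insert.hyps show "\<exists>t\<ge>0. \<exists>c'. (\<forall>u\<in>V. 0 \<le> c' u) \<and>
          (\<Sum>u\<in>insert v V. c u *\<^sub>R u) - t *\<^sub>R v = (\<Sum>u\<in>V. c' u *\<^sub>R u)"
        by (intro exI[of _ "c v"] conjI exI[of _ c]) auto
    next
      fix t c assume t: "0 \<le> t" "\<forall>u\<in>V. 0 \<le> c u" "x - t *\<^sub>R v = (\<Sum>u\<in>V. c u *\<^sub>R u)"
      have "(\<Sum>u\<in>V. (c(v := t)) u *\<^sub>R u) = (\<Sum>u\<in>V. c u *\<^sub>R u)"
        using insert.hyps by (intro sum.cong) auto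
      then have "x = (\<Sum>u\<in>insert v V. (c(v := t)) u *\<^sub>R u)"
        using insert.hyps t(3) by (simp add: algebra_simps)
      with t show "\<exists>c. (\<forall>u\<in>insert v V. 0 \<le> c u) \<and> x = (\<Sum>u\<in>insert v V. c u *\<^sub>R u)"
        by (intro exI[of _ "c(v := t)"]) auto
    qed
    also have "\<dots> \<longleftrightarrow> (\<exists>t\<ge>0. \<forall>a\<in>A. a \<bullet> (x - t *\<^sub>R v) \<le> 0)"
      by (simp only: cone)
    also have "\<dots> \<longleftrightarrow> (\<forall>a\<in>B. a \<bullet> x \<le> 0)"
      unfolding fourier_motzkin[OF A(1)] B_def by (auto simp: ball_Un)
    finally show ?thesis .
  qed
  ultimately show ?case by blast
qed

text \<open>Homogenisation: \<open>x\<close> lies in \<open>P\<close> iff \<open>(x, 1)\<close> lies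
  in the cone generated by the points \<open>(v, 1)\<close>. The last coordinate of a constraint of
  that cone moves to the right-hand side and changes its sign.\<close>

lemma rational_polytope_halfspaces:
  assumes "rational_polytope P"
  shows "\<exists>A. finite A \<and> (\<forall>(a, \<beta>)\<in>A. rational_vector a \<and> \<beta> \<in> \<rat>) \<and>
    P = {x. \<forall>(a, \<beta>)\<in>A. a \<bullet> x \<le> \<beta>}"
proof -
  obtain V where V: "finite V" "\<And>v. v \<in> V \<Longrightarrow> rational_vector v" "P = convex hull V"
    using assms unfolding rational_polytope_def rational_vector_vec by blast
  define W where "W = (\<lambda>v. (v, 1::real)) ` V"
  have ratW: "rational_vector w" if "w \<in> W" for w
    using that V(2) by (auto simp: W_def rational_vector_Pair rational_vector_real)
  have finW: "finite W" using V(1) by (simp add: W_def)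
  obtain A where A: "finite A" "\<And>a. a \<in> A \<Longrightarrow> rational_vector a"
    and cone: "\<And>x. (\<exists>c. (\<forall>v\<in>W. 0 \<le> c v) \<and> x = (\<Sum>v\<in>W. c v *\<^sub>R v)) \<longleftrightarrow> (\<forall>a\<in>A. a \<bullet> x \<le> 0)"
    using rational_cone_halfspaces[OF finW ratW] by blast
  have inj: "inj_on (\<lambda>v. (v, 1::real)) V" by (auto simp: inj_on_def)
  have sum_W: "(\<Sum>v\<in>W. c v *\<^sub>R v) = (\<Sum>v\<in>V. c (v, 1) *\<^sub>R v, \<Sum>v\<in>V. c (v, 1))" for c :: "_ \<Rightarrow> real"
    by (simp add: W_def sum.reindex[OF inj] prod_eq_iff fst_sum snd_sum)
  have "x \<in> P \<longleftrightarrow> (\<forall>(a, \<beta>)\<in>(\<lambda>(a, \<beta>). (a, - \<beta>)) ` A. a \<bullet> x \<le> \<beta>)" for x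
  proof -
    have "x \<in> P \<longleftrightarrow> (\<exists>c. (\<forall>v\<in>W. 0 \<le> c v) \<and> (x, 1) = (\<Sum>v\<in>W. c v *\<^sub>R v))"
      unfolding sum_W V(3) convex_hull_finite[OF V(1)]
    proof safe
      fix u assume u: "\<forall>x\<in>V. (0::real) \<le> u x" "sum u V = 1"
      then show "\<exists>c::_ \<Rightarrow> real. (\<forall>v\<in>W. 0 \<le> c v) \<and>
          (\<Sum>v\<in>V. u v *\<^sub>R v, 1) = (\<Sum>v\<in>V. c (v, 1) *\<^sub>R v, \<Sum>v\<in>V. c (v, 1))"
        by (intro exI[of _ "\<lambda>(v, s). u v"]) (auto simp: W_def)
    next
      fix c :: "_ \<Rightarrow> real" assume "\<forall>v\<in>W. 0 \<le> c v" "1 = (\<Sum>v\<in>V. c (v, 1))"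
      then show "\<exists>u. (\<forall>x\<in>V. 0 \<le> u x) \<and> sum u V = 1 \<and> (\<Sum>v\<in>V. u v *\<^sub>R v) = (\<Sum>v\<in>V. c (v, 1) *\<^sub>R v)"
        by (intro exI[of _ "\<lambda>v. c (v, 1)"]) (auto simp: W_def)
    qed
    also have "\<dots> \<longleftrightarrow> (\<forall>a\<in>A. a \<bullet> (x, 1) \<le> 0)" by (rule cone)
    finally show ?thesis by auto
  qed
  then have "P = {x. \<forall>(a, \<beta>)\<in>(\<lambda>(a, \<beta>). (a, - \<beta>)) ` A. a \<bullet> x \<le> \<beta>}" by blast
  moreover have "\<forall>(a, \<beta>)\<in>(\<lambda>(a, \<beta>). (a, - \<beta>)) ` A. rational_vector a \<and> \<beta> \<in> \<rat>"
    using A(2) rational_vector_Pair rational_vector_real by (fastforce simp: Rats_minus_iff)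
  ultimately show ?thesis using A(1) by blast
qed

lemma common_denominator:
  fixes S :: "real set"
  assumes "finite S" "S \<subseteq> \<rat>"
  shows "\<exists>b::nat. b > 0 \<and> (\<forall>q\<in>S. of_nat b * q \<in> \<int>)"
  using assms
proof (induction S rule: finite_induct)
  case (insert q S)
  then obtain b :: nat where b: "b > 0" "\<And>q. q \<in> S \<Longrightarrow> of_nat b * q \<in> \<int>" by auto
  from insert.prems obtain m n where "n > 0" "q = of_int m / of_int n"
    by (metis Rats_cases' insert_subset)
  then have "of_nat (nat n) * q = of_int m" "nat n > 0" by auto
  then have n: "of_nat (nat n) * q \<in> \<int>" "nat n > 0" using Ints_of_int by metis+
  have "of_nat (b * nat n) * r \<in> \<int>" if "r \<in> insert q S" for r
  proof (cases "r = q")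
    case True
    have "of_nat (b * nat n) * q = of_nat b * (of_nat (nat n) * q)" by simp
    also have "\<dots> \<in> \<int>" using n Ints_mult Ints_of_nat by blast
    finally show ?thesis using True by simp
  next
    case False
    have "of_nat (b * nat n) * r = of_nat (nat n) * (of_nat b * r)" by simp
    also have "\<dots> \<in> \<int>" using b(2)[of r] that False Ints_mult Ints_of_nat by blast
    finally show ?thesis by simp
  qed
  moreover have "b * nat n > 0" using b n by simp
  ultimately show ?case by blast
qed auto

section \<open>Dilates, translates and faces of rational polytopes\<close>

lemma mem_dilate_pos:
  fixes Q :: "(real ^ 'n) set"
  assumes "c > 0"
  shows "x \<in> dilate c Q \<longleftrightarrow> (1 / c) *\<^sub>R x \<in> Q"
proof
  assume "(1 / c) *\<^sub>R x \<in> Q"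
  then have "c *\<^sub>R ((1 / c) *\<^sub>R x) \<in> dilate c Q" by blast
  with assms show "x \<in> dilate c Q" by simp
qed (use assms in auto)

lemma rational_polytope_bounded: "rational_polytope P \<Longrightarrow> bounded P"
  unfolding rational_polytope_def by (auto intro: finite_imp_bounded bounded_convex_hull)

lemma rational_polytope_convex: "rational_polytope P \<Longrightarrow> convex P"
  unfolding rational_polytope_def by auto

lemma rational_polytope_dilate:
  assumes "rational_polytope P" "c \<in> \<rat>"
  shows "rational_polytope (dilate c P)"
proof -
  obtain V where V: "finite V" "\<forall>v\<in>V. \<forall>i. v $ i \<in> \<rat>" "P = convex hull V"
    using assms(1) unfolding rational_polytope_def by blast
  then have "dilate c P = convex hull (dilate c V)" by (simp add: convex_hull_scaling)
  with V assms(2) show ?thesis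
    unfolding rational_polytope_def by (intro exI[of _ "dilate c V"]) auto
qed

lemma rational_polytope_translation:
  assumes "rational_polytope P" "rational_vector v"
  shows "rational_polytope ((+) v ` P)"
proof -
  obtain V where V: "finite V" "\<forall>v\<in>V. \<forall>i. v $ i \<in> \<rat>" "P = convex hull V"
    using assms(1) unfolding rational_polytope_def by blast
  then have "(+) v ` P = convex hull ((+) v ` V)" by (simp add: convex_hull_translation)
  with V assms(2) show ?thesis
    unfolding rational_polytope_def rational_vector_vec by (intro exI[of _ "(+) v ` V"]) auto
qed

text \<open>Every face of a hull of finitely many points is the hull of some of these
  points.\<close>

lemma rational_polytope_face:
  assumes "rational_polytope P" "F face_of P"
  shows "rational_polytope F"
proof -
  obtain V where V: "finite V" "\<forall>v\<in>V. \<forall>i. v $ i \<in> \<rat>" "P = convex hull V"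
    using assms(1) unfolding rational_polytope_def by blast
  then obtain W where "W \<subseteq> V" "F = convex hull W"
    using face_of_convex_hull_subset[OF finite_imp_compact] assms(2) by metis
  with V show ?thesis
    unfolding rational_polytope_def by (intro exI[of _ W]) (auto intro: finite_subset)
qed

text \<open>Since the origin satisfies every inequality, no right-hand side is negative, and the
  positive ones can be scaled to 1. In this form a dilation by \<open>c\<close> only replaces the 1
  by \<open>c\<close>.\<close>

lemma rational_polytope_halfspaces_origin:
  assumes "rational_polytope P" "0 \<in> P"
  shows "\<exists>A B. finite A \<and> finite B \<and> (\<forall>a\<in>B. rational_vector a) \<and>
    P = {x. (\<forall>a\<in>A. a \<bullet> x \<le> 0) \<and> (\<forall>a\<in>B. a \<bullet> x \<le> 1)}"
proof -
  obtain H where H: "finite H" "\<And>a \<beta>. (a, \<beta>) \<in> H \<Longrightarrow> rational_vector a \<and> \<beta> \<in> \<rat>"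
    and P: "P = {x. \<forall>(a, \<beta>)\<in>H. a \<bullet> x \<le> \<beta>}"
    using rational_polytope_halfspaces[OF assms(1)] by blast
  have nonneg: "\<beta> \<ge> 0" if "(a, \<beta>) \<in> H" for a \<beta>
    using assms(2) that unfolding P by fastforce
  define A where "A = fst ` {h \<in> H. snd h = 0}"
  define B where "B = (\<lambda>(a, \<beta>). (1 / \<beta>) *\<^sub>R a) ` {h \<in> H. snd h > 0}"
  have "x \<in> P \<longleftrightarrow> (\<forall>a\<in>A. a \<bullet> x \<le> 0) \<and> (\<forall>a\<in>B. a \<bullet> x \<le> 1)" for x
  proof
    assume "x \<in> P"
    then show "(\<forall>a\<in>A. a \<bullet> x \<le> 0) \<and> (\<forall>a\<in>B. a \<bullet> x \<le> 1)"
      by (fastforce simp: P A_def B_def)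
  next
    assume x: "(\<forall>a\<in>A. a \<bullet> x \<le> 0) \<and> (\<forall>a\<in>B. a \<bullet> x \<le> 1)"
    have "a \<bullet> x \<le> \<beta>" if h: "(a, \<beta>) \<in> H" for a \<beta>
    proof (cases "\<beta> = 0")
      case True
      with h have "a \<in> A" by (force simp: A_def)
      with x True show ?thesis by auto
    next
      case False
      with nonneg[OF h] have "\<beta> > 0" by simp
      with h have "(1 / \<beta>) *\<^sub>R a \<in> B" by (force simp: B_def)
      with x have "((1 / \<beta>) *\<^sub>R a) \<bullet> x \<le> 1" by blast
      with \<open>\<beta> > 0\<close> show ?thesis by (simp add: field_simps)
    qed
    then show "x \<in> P" by (auto simp: P)
  qed
  moreover have "finite A" "finite B" using H(1) by (auto simp: A_def B_def)
  moreover have "\<forall>a\<in>B. rational_vector a"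
    using H(2) by (auto simp: B_def intro!: rational_vector_scaleR)
  ultimately show ?thesis by blast
qed

text \<open>The case \<open>c = 0\<close> says that a bounded polyhedron has a trivial recession cone.\<close>

lemma mem_dilate_halfspaces:
  fixes P :: "(real ^ 'n) set"
  assumes P: "P = {x. (\<forall>a\<in>A. a \<bullet> x \<le> 0) \<and> (\<forall>a\<in>B. a \<bullet> x \<le> 1)}"
    and "bounded P" "c \<ge> 0"
  shows "x \<in> dilate c P \<longleftrightarrow> (\<forall>a\<in>A. a \<bullet> x \<le> 0) \<and> (\<forall>a\<in>B. a \<bullet> x \<le> c)"
proof (cases "c = 0")
  case False
  with assms(3) have "c > 0" by simp
  then show ?thesis
    unfolding mem_dilate_pos[OF \<open>c > 0\<close>] by (simp add: P pos_divide_le_eq zero_le_divide_iff divide_le_0_iff)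
next
  case True
  have "0 \<in> P" by (simp add: P)
  moreover have "x = 0" if x: "\<forall>a\<in>A. a \<bullet> x \<le> 0" "\<forall>a\<in>B. a \<bullet> x \<le> 0"
  proof (rule ccontr)
    assume "x \<noteq> 0"
    obtain R where R: "\<And>y. y \<in> P \<Longrightarrow> norm y \<le> R" using assms(2) by (auto simp: bounded_iff)
    with \<open>0 \<in> P\<close> have "R \<ge> 0" by fastforce
    \<comment> \<open>Gives \<open>s *\<^sub>R x\<close> the norm \<open>R + 1\<close>, which is too
      large for a point of \<open>P\<close>.\<close>
    define s where "s = (R + 1) / norm x"
    have "s \<ge> 0" using \<open>R \<ge> 0\<close> by (simp add: s_def)
    have "s *\<^sub>R x \<in> P"
      using x \<open>s \<ge> 0\<close> by (auto simp: P mult_nonneg_nonpos intro: order_trans[of _ 0])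
    from R[OF this] \<open>x \<noteq> 0\<close> \<open>R \<ge> 0\<close> show False by (simp add: s_def)
  qed
  ultimately show ?thesis using True by auto
qed

section \<open>Counting points of shifted lattices\<close>

text \<open>The coset Z^n + t. Shifts other than 0 arise when a vertex that is not integral is moved
  to the origin.\<close>

definition shifted_lattice :: "real ^ 'n \<Rightarrow> (real ^ 'n) set" where
  "shifted_lattice t = {x. \<forall>i. x $ i - t $ i \<in> \<int>}"

text \<open>The integer offsets from \<open>t\<close> lie in a cube with \<open>2 * M + 1\<close>
  values per coordinate. The explicit bound later limits the degree of the counting
  polynomials.\<close>

lemma shifted_lattice_box:
  fixes S :: "(real ^ 'n) set"
  assumes "\<And>x i. x \<in> S \<Longrightarrow> \<bar>x $ i - t $ i\<bar> \<le> real M"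
  shows "finite (S \<inter> shifted_lattice t)" "card (S \<inter> shifted_lattice t) \<le> (2 * M + 1) ^ CARD('n)"
proof -
  let ?F = "Pi\<^sub>E (UNIV :: 'n set) (\<lambda>_. {- int M..int M})"
  let ?g = "\<lambda>f :: 'n \<Rightarrow> int. \<chi> i. t $ i + of_int (f i)"
  have sub: "S \<inter> shifted_lattice t \<subseteq> ?g ` ?F"
  proof
    fix x assume x: "x \<in> S \<inter> shifted_lattice t"
    define f where "f i = \<lfloor>x $ i - t $ i\<rfloor>" for i
    have f: "of_int (f i) = x $ i - t $ i" for i
      using x by (simp add: f_def shifted_lattice_def)
    have "\<bar>f i\<bar> \<le> int M" for i
    proof -
      have "\<bar>of_int (f i) :: real\<bar> \<le> real M" using assms[of x i] x by (simp add: f)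
      then have "of_int \<bar>f i\<bar> \<le> (of_int (int M) :: real)" by simp
      then show ?thesis by (simp only: of_int_le_iff)
    qed
    then have "f \<in> ?F" by (auto simp: abs_le_iff) (metis minus_le_iff)
    moreover have "x = ?g f" by (simp add: vec_eq_iff f)
    ultimately show "x \<in> ?g ` ?F" by blast
  qed
  have fin: "finite ?F" by (intro finite_PiE) auto
  have "card ?F = (2 * M + 1) ^ CARD('n)" by (simp add: card_PiE nat_add_distrib nat_mult_distrib)
  then show "card (S \<inter> shifted_lattice t) \<le> (2 * M + 1) ^ CARD('n)"
    using card_mono[OF finite_imageI[OF fin] sub] card_image_le[OF fin, of ?g] by simp
  show "finite (S \<inter> shifted_lattice t)" by (rule finite_subset[OF sub finite_imageI[OF fin]])
qed

lemma finite_shifted_lattice: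
  fixes S :: "(real ^ 'n) set"
  assumes "bounded S"
  shows "finite (S \<inter> shifted_lattice t)"
proof -
  obtain R where R: "\<And>x. x \<in> S \<Longrightarrow> norm x \<le> R" using assms by (auto simp: bounded_iff)
  obtain M :: nat where M: "R + norm t \<le> real M" using real_arch_simple by blast
  have "\<bar>x $ i - t $ i\<bar> \<le> real M" if "x \<in> S" for x i
    using R[OF that] M component_le_norm_cart[of x i] component_le_norm_cart[of t i] by linarith
  then show ?thesis by (rule shifted_lattice_box)
qed

lemma finite_dilate_lattice:
  "rational_polytope P \<Longrightarrow> finite (dilate c P \<inter> shifted_lattice t)"
  by (intro finite_shifted_lattice bounded_scaling rational_polytope_bounded)

text \<open>As \<open>x - t\<close> is integral, clearing the denominators of the entries of
  \<open>a\<close> and of \<open>a \<bullet> t\<close> suffices. The values of the functionals on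
  the lattice are then multiples of 1/b, so between consecutive multiples nothing happens.\<close>

lemma shifted_lattice_inner_denominator:
  fixes t :: "real ^ 'n"
  assumes "finite A" "\<And>a. a \<in> A \<Longrightarrow> rational_vector a" "rational_vector t"
  shows "\<exists>b::nat. b > 0 \<and> (\<forall>a\<in>A. \<forall>x\<in>shifted_lattice t. of_nat b * (a \<bullet> x) \<in> \<int>)"
proof -
  let ?S = "(\<lambda>(a, i). a $ i) ` (A \<times> UNIV) \<union> (\<lambda>a. a \<bullet> t) ` A"
  have "finite ?S" using assms(1) by auto
  moreover have "?S \<subseteq> \<rat>"
    using assms(2,3) by (auto intro: rational_vector_inner) (simp add: rational_vector_vec)
  ultimately obtain b :: nat where b: "b > 0" "\<And>q. q \<in> ?S \<Longrightarrow> of_nat b * q \<in> \<int>"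
    using common_denominator by metis
  have "of_nat b * (a \<bullet> x) \<in> \<int>" if a: "a \<in> A" and x: "x \<in> shifted_lattice t" for a x
  proof -
    have "a \<bullet> x = a \<bullet> t + a \<bullet> (x - t)" by (simp add: inner_diff_right)
    also have "a \<bullet> (x - t) = (\<Sum>i\<in>UNIV. a $ i * (x $ i - t $ i))" by (simp add: inner_vec_def)
    finally have "of_nat b * (a \<bullet> x) =
        of_nat b * (a \<bullet> t) + (\<Sum>i\<in>UNIV. (of_nat b * a $ i) * (x $ i - t $ i))"
      by (simp add: distrib_left sum_distrib_left mult.assoc)
    also have "\<dots> \<in> \<int>"
      using a x by (intro Ints_add Ints_sum Ints_mult[of "of_nat b * a $ i" for i] b)
        (auto simp: shifted_lattice_def)
    finally show ?thesis .
  qed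
  with b(1) show ?thesis by blast
qed

section \<open>Ehrhart's theorem for shifted lattices\<close>

text \<open>If \<open>0 \<in> P\<close>, then \<open>((m + 1) / b) P\<close> differs from \<open>(m / b) P\<close>, for a suitable \<open>b\<close>, by the
  lattice points on the dilates of the facets that miss the origin.\<close>

lemma quasi_polynomial_count_origin:
  fixes P :: "(real ^ 'n) set"
  assumes P: "rational_polytope P" and "0 \<in> P" and t: "rational_vector t"
    and IH: "\<And>F. rational_polytope F \<Longrightarrow> aff_dim F < aff_dim P \<Longrightarrow>
      \<exists>d. quasi_polynomial d (\<lambda>k. of_nat (card (dilate (real k) F \<inter> shifted_lattice t)))"
  shows "\<exists>d. quasi_polynomial d (\<lambda>k. of_nat (card (dilate (real k) P \<inter> shifted_lattice t)))"
proof -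
  let ?L = "shifted_lattice t"
  obtain A B where B: "finite B" "\<And>a. a \<in> B \<Longrightarrow> rational_vector a"
    and P_eq: "P = {x. (\<forall>a\<in>A. a \<bullet> x \<le> 0) \<and> (\<forall>a\<in>B. a \<bullet> x \<le> 1)}"
    using rational_polytope_halfspaces_origin[OF P \<open>0 \<in> P\<close>] by blast
  note mem = mem_dilate_halfspaces[OF P_eq rational_polytope_bounded[OF P]]
  obtain b :: nat where b: "b > 0" "\<And>a x. a \<in> B \<Longrightarrow> x \<in> ?L \<Longrightarrow> of_nat b * (a \<bullet> x) \<in> \<int>"
    using shifted_lattice_inner_denominator[OF B t] by blast
  \<comment> \<open>The face on which all inequalities of \<open>S\<close> are tight. Intersections
    of the sets for single \<open>a\<close>, as inclusion-exclusion needs them, are again of this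
    form.\<close>
  define F where "F S = P \<inter> {x. \<forall>a\<in>S. a \<bullet> x = 1}" for S
  have F: "F S face_of P" "aff_dim (F S) < aff_dim P" if "S \<subseteq> B" "S \<noteq> {}" for S
  proof -
    have "F S = \<Inter> ((\<lambda>a. P \<inter> {x. a \<bullet> x = 1}) ` S)" using that by (auto simp: F_def)
    moreover have "P \<inter> {x. a \<bullet> x = 1} face_of P" if "a \<in> B" for a
      using that by (intro face_of_Int_supporting_hyperplane_le rational_polytope_convex P)
        (auto simp: P_eq)
    ultimately show face: "F S face_of P"
      using that by (auto simp del: INT_simps intro!: face_of_Inter)
    \<comment> \<open>At the origin \<open>a \<bullet> x\<close> is 0 and not 1, so the face is
      proper and has smaller dimension.\<close>
    have "0 \<notin> F S" using that by (auto simp: F_def)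
    then have "F S \<noteq> P" using \<open>0 \<in> P\<close> by blast
    with face show "aff_dim (F S) < aff_dim P"
      using face_of_aff_dim_lt rational_polytope_convex[OF P] by blast
  qed
  have F_rat: "rational_polytope (F S)" if "S \<subseteq> B" "S \<noteq> {}" for S
    using rational_polytope_face[OF P F(1)[OF that]] .
  \<comment> \<open>The lattice points that lie on the face for \<open>a\<close> at the level
    (m+1)/b. With \<open>Suc m\<close> the dilation factor is positive, as \<open>mem_F\<close>
    requires.\<close>
  define X where "X a m = dilate (real (Suc m) / real b) (F {a}) \<inter> ?L" for a m
  define N where "N m = card (dilate (real m / real b) P \<inter> ?L)" for m
  have mem_F: "x \<in> dilate c (F S) \<longleftrightarrow> x \<in> dilate c P \<and> (\<forall>a\<in>S. a \<bullet> x = c)" if "c > 0" for c S x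
    using that by (auto simp: mem_dilate_pos F_def field_simps)
  have "\<exists>d. quasi_polynomial d (\<lambda>m. of_nat (card (\<Union>a\<in>B. X a m)))"
  proof (rule quasi_polynomial_card_Union[OF B(1)])
    fix a m assume "a \<in> B"
    then show "finite (X a m)"
      unfolding X_def using F(1)[of "{a}"] by (intro finite_dilate_lattice F_rat) auto
  next
    fix S assume S: "S \<subseteq> B" "S \<noteq> {}"
    \<comment> \<open>The induction hypothesis speaks of integer dilates only, so it is applied to
      the face shrunk by \<open>b\<close>, which has the same dimension.\<close>
    have "aff_dim (dilate (1 / real b) (F S)) = aff_dim (F S)"
      using b(1) by (intro aff_dim_injective_linear_image) (auto simp: inj_on_def)
    then have "\<exists>d. quasi_polynomial d
        (\<lambda>k. of_nat (card (dilate (real k) (dilate (1 / real b) (F S)) \<inter> ?L)))"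
      using F(2)[OF S] by (intro IH rational_polytope_dilate F_rat S) auto
    then obtain d where "quasi_polynomial d
        (\<lambda>k. of_nat (card (dilate (real (Suc k)) (dilate (1 / real b) (F S)) \<inter> ?L)))"
      using quasi_polynomial_Suc_arg by blast
    moreover have "dilate (real (Suc k)) (dilate (1 / real b) (F S)) \<inter> ?L = (\<Inter>a\<in>S. X a k)" for k
    proof -
      have "dilate (real (Suc k)) (dilate (1 / real b) (F S)) = dilate (real (Suc k) / real b) (F S)"
        by (simp add: image_image)
      moreover have pos: "real (Suc k) / real b > 0" using b(1) by simp
      ultimately show ?thesis
        using S(2) unfolding X_def set_eq_iff INT_iff Int_iff by (simp only: mem_F[OF pos]) blast
    qed
    ultimately show "\<exists>d. quasi_polynomial d (\<lambda>m. of_nat (card (\<Inter>a\<in>S. X a m)))" by auto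
  qed
  then obtain d where d: "quasi_polynomial d (\<lambda>m. of_nat (card (\<Union>a\<in>B. X a m)))" by blast
  have step: "N (Suc m) = N m + card (\<Union>a\<in>B. X a m)" for m
  proof -
    define c where "c = real m / real b"
    define c' where "c' = real (Suc m) / real b"
    have c: "c \<ge> 0" "c' > 0" "c < c'"
      using b(1) by (auto simp: c_def c'_def divide_strict_right_mono)
    have X: "x \<in> X a m \<longleftrightarrow> x \<in> ?L \<and> x \<in> dilate c' P \<and> a \<bullet> x = c'" for a x
      using mem_F[OF c(2)] by (auto simp: X_def c'_def)
    \<comment> \<open>\<open>b\<close> times \<open>a \<bullet> x\<close> is an integer that is at
      most \<open>m + 1\<close>, so it is at most \<open>m\<close> or equal to
      \<open>m + 1\<close>.\<close>
    have dich: "a \<bullet> x \<le> c \<or> a \<bullet> x = c'" if h: "a \<in> B" "x \<in> ?L" "a \<bullet> x \<le> c'" for a x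
    proof -
      obtain z where z: "real b * (a \<bullet> x) = of_int z" using b(2)[OF h(1,2)] by (elim Ints_cases)
      have "of_int z \<le> (of_int (int (Suc m)) :: real)"
        using h(3) b(1) by (simp add: z[symmetric] c'_def field_simps)
      then have "z \<le> int m \<or> z = int (Suc m)" unfolding of_int_le_iff by linarith
      then show ?thesis
      proof
        assume "z \<le> int m"
        then have "of_int z \<le> (of_int (int m) :: real)" unfolding of_int_le_iff .
        then have "real b * (a \<bullet> x) \<le> real m" using z by simp
        then show ?thesis using b(1) by (simp add: c_def field_simps)
      next
        assume "z = int (Suc m)"
        then have "real b * (a \<bullet> x) = real (Suc m)" using z by simp
        then show ?thesis using b(1) by (simp add: c'_def field_simps)
      qed
    qed
    have "dilate c' P \<inter> ?L = (dilate c P \<inter> ?L) \<union> (\<Union>a\<in>B. X a m)"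
    proof (intro equalityI subsetI)
      fix x assume x: "x \<in> dilate c' P \<inter> ?L"
      then have AB: "\<forall>a\<in>A. a \<bullet> x \<le> 0" "\<forall>a\<in>B. a \<bullet> x \<le> c'" using mem[of c' x] c by auto
      show "x \<in> (dilate c P \<inter> ?L) \<union> (\<Union>a\<in>B. X a m)"
      proof (cases "\<forall>a\<in>B. a \<bullet> x \<le> c")
        case True
        with AB(1) x show ?thesis using mem[OF c(1), of x] by blast
      next
        case False
        with AB(2) dich x have "\<exists>a\<in>B. a \<bullet> x = c'" by blast
        with x X show ?thesis by blast
      qed
    next
      fix x assume x: "x \<in> (dilate c P \<inter> ?L) \<union> (\<Union>a\<in>B. X a m)"
      have "x \<in> dilate c' P" if "x \<in> dilate c P"
        using that mem[OF c(1), of x] mem[of c' x] c by fastforce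
      with x X show "x \<in> dilate c' P \<inter> ?L" by blast
    qed
    moreover have "(dilate c P \<inter> ?L) \<inter> (\<Union>a\<in>B. X a m) = {}"
    proof -
      have False if "x \<in> dilate c P" "a \<in> B" "x \<in> X a m" for x a
        using that mem[OF c(1), of x] X c(3) by force
      then show ?thesis by blast
    qed
    moreover have "finite (dilate c P \<inter> ?L)" using P by (rule finite_dilate_lattice)
    moreover have "finite (\<Union>a\<in>B. X a m)"
      by (rule finite_subset[OF _ finite_dilate_lattice[OF P, of c' t]]) (auto simp: X)
    ultimately show ?thesis unfolding N_def c_def[symmetric] c'_def[symmetric]
      by (metis card_Un_disjoint)
  qed
  have "of_nat (N m) = (of_nat (N 0) + 1 * (\<Sum>i<m. of_nat (card (\<Union>a\<in>B. X a i))) :: rat)" for m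
    by (induction m) (simp_all add: step)
  then have "(\<lambda>m. of_nat (N m)) =
      (\<lambda>m. of_nat (N 0) + 1 * (\<Sum>i<m. of_nat (card (\<Union>a\<in>B. X a i))) :: rat)" by (rule ext)
  moreover have "quasi_polynomial (1 * d) \<dots>"
    by (rule quasi_polynomial_lincomb[OF quasi_polynomial_const quasi_polynomial_partial_sum[OF d]])
  ultimately have "quasi_polynomial (1 * d) (\<lambda>m. of_nat (N m))" by (rule ssubst[where P = "quasi_polynomial (1 * d)"])
  \<comment> \<open>The numerators divisible by \<open>b\<close> are the integer dilations of
    \<open>P\<close>.\<close>
  then have "quasi_polynomial (1 * d) (\<lambda>k. of_nat (N (b * k)))"
    by (rule quasi_polynomial_mult_arg)
  moreover have "N (b * k) = card (dilate (real k) P \<inter> ?L)" for k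
    using b(1) by (simp add: N_def)
  ultimately show ?thesis by auto
qed

text \<open>Translation by \<open>- c *\<^sub>R v\<close> carries the lattice shifted by
  \<open>t\<close> to the one shifted by \<open>t - c *\<^sub>R v\<close>, which by the hypothesis
  is the one shifted by \<open>s\<close>.\<close>

lemma dilate_translation_shifted_lattice:
  fixes P :: "(real ^ 'n) set"
  assumes "\<And>i. (t - s - c *\<^sub>R v) $ i \<in> \<int>"
  shows "card (dilate c P \<inter> shifted_lattice t) = card (dilate c ((+) (- v) ` P) \<inter> shifted_lattice s)"
proof -
  let ?h = "\<lambda>x. x - c *\<^sub>R v"
  have Ints_iff: "p + q \<in> \<int> \<longleftrightarrow> p \<in> \<int>" if "q \<in> \<int>" for p q :: real
    using that Ints_add[of p q] Ints_diff[of "p + q" q] by auto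
  have iff: "(?h x \<in> shifted_lattice s) = (x \<in> shifted_lattice t)" for x
  proof -
    have "?h x $ i - s $ i = (x $ i - t $ i) + (t - s - c *\<^sub>R v) $ i" for i by simp
    then show ?thesis
      unfolding shifted_lattice_def mem_Collect_eq by (simp only: Ints_iff[OF assms])
  qed
  have "?h ` (dilate c P \<inter> shifted_lattice t) = ?h ` dilate c P \<inter> shifted_lattice s"
    using iff by blast
  moreover have "?h ` dilate c P = dilate c ((+) (- v) ` P)"
    by (simp add: image_image scaleR_diff_right)
  ultimately have "?h ` (dilate c P \<inter> shifted_lattice t) = dilate c ((+) (- v) ` P) \<inter> shifted_lattice s"
    by simp
  moreover have "inj ?h" by (simp add: inj_on_def)
  ultimately show ?thesis by (metis card_image inj_on_subset subset_UNIV)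
qed

text \<open>Induction on the dimension with \<open>t\<close> arbitrary, since moving a vertex to the
  origin alters the shift. The added 1 keeps the empty face, of dimension -1, strictly below a
  single point.\<close>

theorem quasi_polynomial_count:
  fixes P :: "(real ^ 'n) set"
  assumes "rational_polytope P" "rational_vector t"
  shows "\<exists>d. quasi_polynomial d (\<lambda>k. of_nat (card (dilate (real k) P \<inter> shifted_lattice t)))"
  using assms
proof (induction "nat (aff_dim P + 1)" arbitrary: P t rule: less_induct)
  case less
  show ?case
  proof (cases "P = {}")
    case True
    then show ?thesis using quasi_polynomial_const[of 0] by auto
  next
    case False
    obtain V where V: "finite V" "\<And>v. v \<in> V \<Longrightarrow> rational_vector v" "P = convex hull V"
      using less.prems(1) unfolding rational_polytope_def rational_vector_vec by blast
    with False obtain v where "v \<in> V" by fastforce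
    then have v: "v \<in> P" "rational_vector v" using V by (auto intro: hull_inc)
    let ?Q = "(+) (- v) ` P"
    have Q: "rational_polytope ?Q" "0 \<in> ?Q" "aff_dim ?Q = aff_dim P"
      using v less.prems(1) aff_dim_translation_eq[of "- v" P]
      by (simp_all only: rational_polytope_translation rational_vector_uminus) force
    have "finite (range (($) v))" "range (($) v) \<subseteq> \<rat>" using v(2) by (auto simp: rational_vector_vec)
    from common_denominator[OF this]
    \<comment> \<open>Dilating by \<open>j + l * d\<close> moves the vertex by
      \<open>j *\<^sub>R v\<close> up to an integer vector, so within a residue class one shift
      serves all dilates.\<close>
    obtain d :: nat where d: "d > 0" "\<And>i. real d * v $ i \<in> \<int>" by auto
    show ?thesis
    proof (rule quasi_polynomial_residues[OF d(1)])
      fix j assume "j < d"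
      let ?s = "t - real j *\<^sub>R v"
      have s: "rational_vector ?s"
        using v(2) less.prems(2) by (intro rational_vector_diff rational_vector_scaleR) auto
      let ?g = "\<lambda>k. of_nat (card (dilate (real k) ?Q \<inter> shifted_lattice ?s))"
      have "\<exists>e. quasi_polynomial e ?g"
      proof (rule quasi_polynomial_count_origin[OF Q(1,2) s])
        fix F :: "(real ^ 'n) set"
        assume "rational_polytope F" "aff_dim F < aff_dim ?Q"
        then show "\<exists>d. quasi_polynomial d (\<lambda>k. of_nat (card (dilate (real k) F \<inter> shifted_lattice ?s)))"
          using s Q(3) aff_dim_geq[of F] by (intro less.hyps) auto
      qed
      moreover have "card (dilate (real (j + l * d)) P \<inter> shifted_lattice t)
          = card (dilate (real (j + l * d)) ?Q \<inter> shifted_lattice ?s)" for l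
      proof (rule dilate_translation_shifted_lattice)
        fix i
        have "(t - ?s - real (j + l * d) *\<^sub>R v) $ i = - (real l * (real d * v $ i))"
          by (simp add: algebra_simps)
        also have "\<dots> \<in> \<int>" using d(2)[of i] Ints_minus Ints_mult Ints_of_nat by blast
        finally show "(t - ?s - real (j + l * d) *\<^sub>R v) $ i \<in> \<int>" .
      qed
      ultimately have "\<exists>e. quasi_polynomial e ?g \<and>
          (\<forall>l. of_nat (card (dilate (real (j + l * d)) P \<inter> shifted_lattice t)) = ?g (j + l * d))"
        by metis
      then show "\<exists>e g. quasi_polynomial e g \<and>
          (\<forall>l. of_nat (card (dilate (real (j + l * d)) P \<inter> shifted_lattice t)) = g (j + l * d))"
        by (elim exE, intro exI)
    qed
  qed
qed

section \<open>Ehrhart coefficients\<close>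

lemma lattice_points_shifted: "lattice_points S = S \<inter> shifted_lattice 0"
  by (auto simp: lattice_points_def shifted_lattice_def)

lemma finite_lattice_points_dilate:
  "rational_polytope P \<Longrightarrow> finite (lattice_points (dilate c P))"
  unfolding lattice_points_shifted by (rule finite_dilate_lattice)

text \<open>Growth of order at most k^n, which caps the degree of the quasi-polynomial at the
  dimension.\<close>

lemma card_lattice_points_dilate_le:
  fixes P :: "(real ^ 'n) set"
  assumes "rational_polytope P"
  shows "\<exists>M. \<forall>k. card (lattice_points (dilate (real k) P)) \<le> (2 * (k * M) + 1) ^ CARD('n)"
proof -
  obtain R where R: "\<And>x. x \<in> P \<Longrightarrow> norm x \<le> R"
    using rational_polytope_bounded[OF assms] by (auto simp: bounded_iff)
  obtain M :: nat where M: "R \<le> real M" using real_arch_simple by blast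
  have "\<bar>x $ i - (0 :: real ^ 'n) $ i\<bar> \<le> real (k * M)" if x: "x \<in> dilate (real k) P" for x k i
  proof -
    obtain y where y: "y \<in> P" "x = real k *\<^sub>R y" using x by blast
    have "\<bar>y $ i\<bar> \<le> real M" using component_le_norm_cart[of y i] R[OF y(1)] M by linarith
    then show ?thesis by (simp add: y(2) abs_mult mult_left_mono)
  qed
  from shifted_lattice_box(2)[OF this] show ?thesis
    unfolding lattice_points_shifted by blast
qed

lemma is_ehrhart_coeffs_exists:
  fixes P :: "(real ^ 'n) set"
  assumes "rational_polytope P"
  shows "\<exists>G. is_ehrhart_coeffs P G"
proof -
  let ?n = "CARD('n)"
  define f where "f k = card (lattice_points (dilate (real k) P))" for k
  have "rational_vector (0 :: real ^ 'n)" by (simp add: rational_vector_vec)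
  from quasi_polynomial_count[OF assms this]
  obtain d where d: "quasi_polynomial d (\<lambda>k. of_nat (f k))"
    unfolding f_def lattice_points_shifted by blast
  then have "d > 0" unfolding quasi_polynomial_def by simp
  obtain p :: "nat \<Rightarrow> rat poly" where p: "\<And>j l. of_nat (f (j + l * d)) = poly (p j) (of_nat l)"
    using d unfolding quasi_polynomial_def by metis
  obtain M where M: "\<And>k. f k \<le> (2 * (k * M) + 1) ^ ?n"
    unfolding f_def using card_lattice_points_dilate_le[OF assms] by blast
  have deg: "degree (p j) \<le> ?n" for j
  proof (rule ccontr)
    assume "\<not> degree (p j) \<le> ?n"
    then have big: "degree (p j) > ?n" by simp
    \<comment> \<open>The growth bound at \<open>j + l * d\<close>, as a polynomial in
      \<open>l\<close>. If \<open>p j\<close> had larger degree, its sign would decide that of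
      \<open>L - p j\<close>, and its leading coefficient would be both nonpositive and
      nonnegative.\<close>
    define L where "L = [:of_nat (2 * j * M + 1), of_nat (2 * d * M) :: rat:] ^ ?n"
    have "degree L \<le> degree [:of_nat (2 * j * M + 1), of_nat (2 * d * M) :: rat:] * ?n"
      unfolding L_def by (rule degree_power_le)
    also have "\<dots> \<le> ?n" by simp
    finally have "degree L < degree (p j)" using big by simp
    then have "degree (- p j) > degree L" by simp
    then have lc: "lead_coeff (L + (- p j)) = lead_coeff (- p j)" by (rule lead_coeff_add_le)
    have "poly (L + (- p j)) (of_nat l) \<ge> 0" for l
    proof -
      have "(of_nat (f (j + l * d)) :: rat) \<le> of_nat ((2 * ((j + l * d) * M) + 1) ^ ?n)"
        using M[of "j + l * d"] by (simp only: of_nat_le_iff)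
      also have "\<dots> = poly L (of_nat l)"
        by (simp add: L_def algebra_simps)
      finally show ?thesis by (simp add: p)
    qed
    from lead_coeff_nonneg[OF this] have "lead_coeff (p j) \<le> 0" unfolding lc by simp
    moreover have "poly (p j) (of_nat l) \<ge> 0" for l unfolding p[symmetric] by simp
    then have "lead_coeff (p j) \<ge> 0" by (rule lead_coeff_nonneg)
    ultimately have "p j = 0" by simp
    with big show False by simp
  qed
  \<comment> \<open>Substitutes \<open>l = (k - j) / d\<close>, so that the polynomial is in the
    dilation factor \<open>k\<close> itself.\<close>
  define g where "g j = pcompose (p j) [:- of_nat j / of_nat d, 1 / of_nat d:]" for j
  have deg_g: "degree (g j) \<le> ?n" for j
    using degree_pcompose_le[of "p j" "[:- of_nat j / of_nat d, 1 / of_nat d:]"] deg[of j]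
    by (simp add: g_def split: if_splits)
  have "is_ehrhart_coeffs P (\<lambda>i k. coeff (g (k mod d)) i)"
    unfolding is_ehrhart_coeffs_def
  proof (intro conjI allI impI)
    fix i :: nat
    show "\<exists>e>0. \<forall>k. coeff (g ((k + e) mod d)) i = coeff (g (k mod d)) i"
      using \<open>d > 0\<close> by (intro exI[of _ d]) simp
    fix k
    show "coeff (g (k mod d)) i = 0" if "i > ?n"
      using deg_g[of "k mod d"] that by (intro coeff_eq_0) simp
  next
    fix k
    have "(of_nat k :: rat) = of_nat (k mod d) + of_nat (k div d) * of_nat d"
      by (metis add.commute div_mult_mod_eq of_nat_add of_nat_mult)
    then have "poly [:- of_nat (k mod d) / of_nat d, 1 / of_nat d:] (of_nat k) = (of_nat (k div d) :: rat)"
      using \<open>d > 0\<close> by (simp add: field_simps)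
    then have "of_nat (f k) = poly (g (k mod d)) (of_nat k)"
      using p[of "k mod d" "k div d"] by (simp add: g_def poly_pcompose)
    also have "\<dots> = (\<Sum>i\<le>?n. coeff (g (k mod d)) i * of_nat k ^ i)"
      by (rule poly_sum_upto_degree[OF deg_g])
    finally show "of_nat (card (lattice_points (dilate (real k) P))) =
        (\<Sum>i\<le>?n. coeff (g (k mod d)) i * of_nat k ^ i)" by (simp only: f_def)
  qed
  then show ?thesis by blast
qed

text \<open>The coefficients at \<open>r\<close> are pinned down by the lattice point counts along any arithmetic
  progression that starts in \<open>r\<close> and on which they do not change.\<close>

definition coeffs_along :: "(real ^ 'n) set \<Rightarrow> nat \<Rightarrow> rat \<Rightarrow> (nat \<Rightarrow> rat) \<Rightarrow> bool" where
  "coeffs_along P D r q \<longleftrightarrow> D > 0 \<and>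
    (\<forall>l. of_nat (card (lattice_points (dilate (real_of_rat (r + of_nat l * of_nat D)) P))) =
      poly (\<Sum>i\<le>CARD('n). monom (q i) i) (r + of_nat l * of_nat D))"

lemma coeffs_along_mult:
  assumes "coeffs_along P D r q" "m > 0"
  shows "coeffs_along P (m * D) r q"
  unfolding coeffs_along_def
proof (intro conjI allI)
  fix l
  have "(of_nat l * of_nat (m * D) :: rat) = of_nat (l * m) * of_nat D" by simp
  then show "of_nat (card (lattice_points (dilate (real_of_rat (r + of_nat l * of_nat (m * D))) P))) =
      poly (\<Sum>i\<le>CARD('a). monom (q i) i) (r + of_nat l * of_nat (m * D))"
    using assms(1) unfolding coeffs_along_def by metis
qed (use assms in \<open>auto simp: coeffs_along_def\<close>)

text \<open>The progressions with differences \<open>D\<close> and \<open>E\<close> share the one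
  with difference \<open>E * D\<close>, and its infinitely many points determine the
  polynomial.\<close>

lemma coeffs_along_unique:
  fixes P :: "(real ^ 'n) set"
  assumes "coeffs_along P D r q" "coeffs_along P E r q'" "i \<le> CARD('n)"
  shows "q i = q' i"
proof -
  have "D > 0" "E > 0" using assms unfolding coeffs_along_def by auto
  then have "coeffs_along P (E * D) r q" "coeffs_along P (E * D) r q'"
    using coeffs_along_mult[OF assms(1), of E] coeffs_along_mult[OF assms(2), of D]
    by (simp_all add: mult.commute)
  then have "poly (\<Sum>i\<le>CARD('n). monom (q i) i) (r + of_nat l * of_nat (E * D)) =
      poly (\<Sum>i\<le>CARD('n). monom (q' i) i) (r + of_nat l * of_nat (E * D))" for l
    unfolding coeffs_along_def by metis
  then have "(\<Sum>i\<le>CARD('n). monom (q i) i) = (\<Sum>i\<le>CARD('n). monom (q' i) i)"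
    using \<open>D > 0\<close> \<open>E > 0\<close> by (intro poly_eqI_of_nat[of "of_nat (E * D)"]) auto
  then show ?thesis using assms(3) coeff_monom_sum by metis
qed

section \<open>From integer dilates of P/b to rational dilates of P\<close>

lemma is_ehrhart_coeffs_period:
  fixes P :: "(real ^ 'n) set"
  assumes "is_ehrhart_coeffs P G"
  shows "\<exists>D>0. \<forall>i k l. G i (k + l * D) = G i k"
proof -
  obtain d where d: "\<And>i. i \<le> CARD('n) \<Longrightarrow> d i > 0"
    "\<And>i k. i \<le> CARD('n) \<Longrightarrow> G i (k + d i) = G i k"
    using assms unfolding is_ehrhart_coeffs_def by metis
  have mult: "G i (k + l * d i) = G i k" if "i \<le> CARD('n)" for i k l
    using d(2)[OF that, of "k + l' * d i" for l'] by (induction l) (auto simp: add_ac)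
  define D where "D = (\<Prod>i\<le>CARD('n). d i)"
  have "G i (k + l * D) = G i k" for i k l
  proof (cases "i \<le> CARD('n)")
    case True
    then have "d i dvd D" unfolding D_def by (intro dvd_prodI) auto
    then obtain m where "D = m * d i" by (metis dvd_div_mult_self)
    then show ?thesis using mult[OF True, of k "l * m"] by (simp add: mult.assoc)
  next
    case False
    then show ?thesis using assms unfolding is_ehrhart_coeffs_def by simp
  qed
  moreover have "D > 0" using d(1) by (simp add: D_def prod_pos)
  ultimately show ?thesis by blast
qed

text \<open>The dilate of \<open>P\<close> by k/b is the k-th dilate of P/b. The factor
  \<open>of_nat b ^ i\<close> compensates for writing the polynomial in k/b instead of k.\<close>

lemma is_ehrhart_coeffs_along:
  fixes P :: "(real ^ 'n) set"
  assumes "is_ehrhart_coeffs (dilate (1 / real b) P) G" "b > 0"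
  shows "\<exists>D. coeffs_along P D (of_nat a / of_nat b) (\<lambda>i. of_nat b ^ i * G i a)"
proof -
  obtain D where D: "D > 0" "\<And>i k l. G i (k + l * D) = G i k"
    using is_ehrhart_coeffs_period[OF assms(1)] by blast
  have "coeffs_along P D (of_nat a / of_nat b) (\<lambda>i. of_nat b ^ i * G i a)"
    unfolding coeffs_along_def
  proof (intro conjI allI)
    fix l
    \<comment> \<open>Congruent to \<open>a\<close> modulo the period \<open>D\<close>, while the
      factor \<open>b\<close> makes k/b advance in steps of \<open>D\<close>.\<close>
    let ?k = "a + (l * b) * D"
    have x: "of_nat a / of_nat b + of_nat l * of_nat D = (of_nat ?k / of_nat b :: rat)"
      using assms(2) by (simp add: field_simps)
    have "dilate (real_of_rat (of_nat ?k / of_nat b)) P = dilate (real ?k) (dilate (1 / real b) P)"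
      by (simp add: image_image of_rat_divide of_rat_add of_rat_mult)
    then have "of_nat (card (lattice_points (dilate (real_of_rat (of_nat ?k / of_nat b)) P))) =
        (\<Sum>i\<le>CARD('n). G i ?k * of_nat ?k ^ i)"
      using assms(1) unfolding is_ehrhart_coeffs_def by metis
    also have "\<dots> = (\<Sum>i\<le>CARD('n). (of_nat b ^ i * G i a) * (of_nat ?k / of_nat b) ^ i)"
      using assms(2) D(2)[of _ a "l * b"] by (intro sum.cong) (simp_all add: power_divide)
    finally show "of_nat (card (lattice_points (dilate (real_of_rat
        (of_nat a / of_nat b + of_nat l * of_nat D)) P))) =
        poly (\<Sum>i\<le>CARD('n). monom (of_nat b ^ i * G i a) i) (of_nat a / of_nat b + of_nat l * of_nat D)"
      unfolding x poly_monom_sum .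
  qed (rule D(1))
  then show ?thesis by blast
qed

text \<open>With denominator 1 both families give coefficients along progressions starting at
  \<open>k\<close>; above the dimension both vanish by definition.\<close>

lemma is_ehrhart_coeffs_unique:
  fixes P :: "(real ^ 'n) set"
  assumes "is_ehrhart_coeffs P G" "is_ehrhart_coeffs P H"
  shows "G = H"
proof (intro ext)
  fix i k
  have "is_ehrhart_coeffs (dilate (1 / real 1) P) G" "is_ehrhart_coeffs (dilate (1 / real 1) P) H"
    using assms by simp_all
  then obtain D E where
    GH: "coeffs_along P D (of_nat k / of_nat 1) (\<lambda>i. of_nat 1 ^ i * G i k)"
      "coeffs_along P E (of_nat k / of_nat 1) (\<lambda>i. of_nat 1 ^ i * H i k)"
    using is_ehrhart_coeffs_along zero_less_one by metis
  show "G i k = H i k"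
  proof (cases "i \<le> CARD('n)")
    case True
    from coeffs_along_unique[OF GH this] show ?thesis by simp
  next
    case False
    then show ?thesis using assms unfolding is_ehrhart_coeffs_def by simp
  qed
qed

lemma is_ehrhart_coeffs_ehrhart_coeff:
  assumes "rational_polytope P"
  shows "is_ehrhart_coeffs P (ehrhart_coeff P)"
proof -
  obtain G where G: "is_ehrhart_coeffs P G" using is_ehrhart_coeffs_exists[OF assms] by blast
  show ?thesis
    unfolding ehrhart_coeff_def using G is_ehrhart_coeffs_unique[OF _ G]
    by (rule theI[where P = "is_ehrhart_coeffs P"])
qed

text \<open>Contains the independence of the representation a/b: each one yields coefficients along
  a progression from \<open>r\<close>, and these are unique. Hence the definite description has a
  value for every index up to the dimension.\<close>

lemma rational_ehrhart_coeff_along: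
  fixes P :: "(real ^ 'n) set"
  assumes P: "rational_polytope P" and "r \<ge> 0"
  shows "\<exists>D. coeffs_along P D r (\<lambda>i. rational_ehrhart_coeff P i r)"
proof -
  let ?q = "\<lambda>a b i. of_nat b ^ i * ehrhart_coeff (dilate (1 / real b) P) i a"
  have rep: "\<exists>D. coeffs_along P D r (?q a b)" if "b > 0" "r = of_nat a / of_nat b" for a b
    using that is_ehrhart_coeffs_along[of b P _ a]
      is_ehrhart_coeffs_ehrhart_coeff[OF rational_polytope_dilate[OF P]] by auto
  obtain m n where "n > 0" "r = of_int m / of_int n" by (metis Fract_of_int_quotient Rat_cases)
  with \<open>r \<ge> 0\<close> have "m \<ge> 0" by (simp add: zero_le_divide_iff)
  with \<open>n > 0\<close> \<open>r = _\<close> have a0: "nat n > 0" "r = of_nat (nat m) / of_nat (nat n)" by auto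
  obtain D where D: "coeffs_along P D r (?q (nat m) (nat n))" using rep[OF a0] by blast
  have "rational_ehrhart_coeff P i r = ?q (nat m) (nat n) i" if i: "i \<le> CARD('n)" for i
    unfolding rational_ehrhart_coeff_def
  proof (rule the_equality)
    show "\<forall>a b. b > 0 \<and> r = of_nat a / of_nat b \<longrightarrow> ?q (nat m) (nat n) i = ?q a b i"
    proof (intro allI impI)
      fix a b assume "b > 0 \<and> r = of_nat a / of_nat b"
      then obtain E where "coeffs_along P E r (?q a b)" using rep by blast
      from coeffs_along_unique[OF D this i] show "?q (nat m) (nat n) i = ?q a b i" .
    qed
  qed (use a0 in blast)
  then have "(\<Sum>i\<le>CARD('n). monom (rational_ehrhart_coeff P i r) i) =
      (\<Sum>i\<le>CARD('n). monom (?q (nat m) (nat n) i) i)"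
    by (intro sum.cong) auto
  with D show ?thesis unfolding coeffs_along_def by auto
qed

section \<open>The leading coefficient\<close>

lemma full_dim_contains_box:
  fixes P :: "(real ^ 'n) set"
  assumes "convex P" "aff_dim P = int CARD('n)"
  shows "\<exists>c \<epsilon>. \<epsilon> > 0 \<and> (\<forall>x. (\<forall>i. \<bar>x $ i - c $ i\<bar> \<le> \<epsilon>) \<longrightarrow> x \<in> P)"
proof -
  have "affine hull P = UNIV" using assms(2) aff_dim_eq_full[of P] by simp
  moreover have "P \<noteq> {}" using assms(2) by auto
  ultimately have "interior P \<noteq> {}"
    using \<open>P \<noteq> {}\<close> assms(1) rel_interior_interior[of P] rel_interior_eq_empty[of P] by simp
  then obtain c where "c \<in> interior P" by blast
  then obtain e where e: "e > 0" "cball c e \<subseteq> P" using mem_interior_cball by blast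
  \<comment> \<open>If each coordinate differs by at most e/n, the sum of the differences is at most
    \<open>e\<close>, and it dominates the Euclidean norm.\<close>
  define \<epsilon> where "\<epsilon> = e / real CARD('n)"
  have "x \<in> P" if x: "\<And>i. \<bar>x $ i - c $ i\<bar> \<le> \<epsilon>" for x
  proof -
    have "norm (x - c) \<le> (\<Sum>i\<in>UNIV. \<bar>(x - c) $ i\<bar>)" by (rule norm_le_l1_cart)
    also have "\<dots> \<le> (\<Sum>i\<in>(UNIV :: 'n set). \<epsilon>)" using x by (intro sum_mono) simp
    also have "\<dots> = e" by (simp add: \<epsilon>_def)
    finally show ?thesis using e(2) by (auto simp: dist_norm norm_minus_commute)
  qed
  moreover have "\<epsilon> > 0" using e(1) by (simp add: \<epsilon>_def)
  ultimately show ?thesis by blast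
qed

text \<open>Rounding \<open>y * c $ i\<close> up costs less than 1, so adding any of 0, ..., m - 1
  keeps the coordinate within \<open>m\<close> of the centre.\<close>

lemma card_lattice_points_dilate_ge:
  fixes P :: "(real ^ 'n) set"
  assumes P: "rational_polytope P" and box: "\<And>x. (\<And>i. \<bar>x $ i - c $ i\<bar> \<le> \<epsilon>) \<Longrightarrow> x \<in> P"
    and y: "y > 0" "real m \<le> y * \<epsilon>"
  shows "m ^ CARD('n) \<le> card (lattice_points (dilate y P))"
proof -
  let ?F = "Pi\<^sub>E (UNIV :: 'n set) (\<lambda>_. {0..<int m})"
  let ?g = "\<lambda>f :: 'n \<Rightarrow> int. (\<chi> i. of_int (\<lceil>y * c $ i\<rceil> + f i)) :: real ^ 'n"
  have "?g ` ?F \<subseteq> lattice_points (dilate y P)"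
  proof safe
    fix f assume f: "f \<in> ?F"
    have "\<bar>((1 / y) *\<^sub>R ?g f) $ i - c $ i\<bar> \<le> \<epsilon>" for i
    proof -
      have "f i \<in> {0..<int m}" using f by auto
      then have "0 \<le> f i" "f i + 1 \<le> int m" by auto
      then have "0 \<le> real_of_int (f i)" "real_of_int (f i) + 1 \<le> real m" by linarith+
      then have "\<bar>real_of_int (\<lceil>y * c $ i\<rceil> + f i) - y * c $ i\<bar> \<le> y * \<epsilon>"
        using y(2) by (simp add: abs_le_iff) linarith
      moreover have "((1 / y) *\<^sub>R ?g f) $ i - c $ i = (real_of_int (\<lceil>y * c $ i\<rceil> + f i) - y * c $ i) / y"
        using y(1) by (simp add: field_simps)
      ultimately show ?thesis using y(1) by (simp add: abs_divide pos_divide_le_eq mult.commute)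
    qed
    then have "?g f \<in> dilate y P" unfolding mem_dilate_pos[OF y(1)] by (rule box)
    then show "?g f \<in> lattice_points (dilate y P)" by (simp add: lattice_points_def)
  qed
  moreover have "inj ?g" by (auto simp: inj_on_def vec_eq_iff)
  moreover have "card ?F = m ^ CARD('n)" by (simp add: card_PiE)
  ultimately show ?thesis
    using finite_lattice_points_dilate[OF P] card_mono
    by (metis (no_types, lifting) card_image inj_on_subset subset_UNIV)
qed

text \<open>Otherwise the count along the progression would have degree below n in \<open>l\<close>,
  although the dilates contain boxes with at least l^n lattice points.\<close>

lemma coeffs_along_leading:
  fixes P :: "(real ^ 'n) set"
  assumes P: "rational_polytope P" and dim: "aff_dim P = int CARD('n)"
    and q: "coeffs_along P D r q" and "r \<ge> 0"
  shows "q (CARD('n)) \<noteq> 0"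
proof
  let ?n = "CARD('n)"
  assume zero: "q ?n = 0"
  obtain c \<epsilon> where \<epsilon>: "\<epsilon> > 0" "\<And>x. (\<And>i. \<bar>x $ i - c $ i\<bar> \<le> \<epsilon>) \<Longrightarrow> x \<in> P"
    using full_dim_contains_box[OF rational_polytope_convex[OF P] dim] by metis
  obtain k :: nat where k: "1 / \<epsilon> \<le> real k" using real_arch_simple by blast
  with \<epsilon>(1) have "k > 0" by (cases k) (auto simp: field_simps)
  \<comment> \<open>Lengthens the step until each one widens the inscribed box by at least
    1.\<close>
  define E where "E = k * D"
  have E: "coeffs_along P E r q" unfolding E_def using q \<open>k > 0\<close> by (rule coeffs_along_mult)
  have "k \<le> E" using q by (simp add: coeffs_along_def E_def)
  have "1 \<le> real k * \<epsilon>" using k \<epsilon>(1) by (simp add: pos_divide_le_eq)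
  also have "\<dots> \<le> real E * \<epsilon>"
    using \<open>k \<le> E\<close> \<epsilon>(1) by (intro mult_right_mono) auto
  finally have E\<epsilon>: "1 \<le> real E * \<epsilon>" .
  define S where "S = (\<Sum>i\<le>?n. monom (q i) i)"
  have "degree S < ?n"
  proof (rule degree_lessI)
    show "S \<noteq> 0 \<or> ?n > 0" by simp
    show "\<forall>k\<ge>?n. coeff S k = 0" using zero by (auto simp: S_def coeff_monom_sum)
  qed
  \<comment> \<open>The count minus l^n: nonnegative at every natural number, yet with leading
    coefficient -1.\<close>
  define T where "T = pcompose S [:r, of_nat E:] + monom (-1) ?n"
  have "degree (pcompose S [:r, of_nat E:]) \<le> degree S"
    using degree_pcompose_le[of S "[:r, of_nat E:]"] by (auto split: if_splits)
  with \<open>degree S < ?n\<close> have "degree (pcompose S [:r, of_nat E:]) < degree (monom (-1::rat) ?n)"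
    by (simp add: degree_monom_eq)
  then have "lead_coeff (pcompose S [:r, of_nat E:] + monom (-1) ?n) = lead_coeff (monom (-1::rat) ?n)"
    by (rule lead_coeff_add_le)
  then have "lead_coeff T = -1" unfolding T_def[symmetric] by (simp add: degree_monom_eq)
  moreover have "poly T (of_nat l) \<ge> 0" for l
  proof (cases "l = 0")
    \<comment> \<open>Here the dilation factor is \<open>r\<close>, possibly 0, where the box bound
      does not apply; it is enough that 0^n = 0.\<close>
    case True
    have "(0::rat) \<le> of_nat (card (lattice_points (dilate (real_of_rat (r + of_nat 0 * of_nat E)) P)))"
      by simp
    also have "\<dots> = poly S (r + of_nat 0 * of_nat E)" using E unfolding coeffs_along_def S_def by blast
    finally show ?thesis using True by (simp add: T_def poly_monom poly_pcompose zero_power)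
  next
    case False
    let ?y = "real_of_rat (r + of_nat l * of_nat E)"
    have "real l \<le> real l * (real E * \<epsilon>)" using E\<epsilon> mult_left_mono[of 1 "real E * \<epsilon>" "real l"] by simp
    also have "\<dots> \<le> ?y * \<epsilon>"
      using \<open>r \<ge> 0\<close> \<epsilon>(1) by (simp add: of_rat_add of_rat_mult algebra_simps)
    finally have "real l \<le> ?y * \<epsilon>" .
    moreover from this False \<epsilon>(1) have "?y > 0"
      by (metis less_le_trans of_nat_0_less_iff not_gr_zero zero_less_mult_pos2)
    ultimately have "l ^ ?n \<le> card (lattice_points (dilate ?y P))"
      using \<epsilon>(2) by (intro card_lattice_points_dilate_ge[OF P]) auto
    then have "of_nat (l ^ ?n) \<le> (of_nat (card (lattice_points (dilate ?y P))) :: rat)"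
      by (simp only: of_nat_le_iff)
    also have "\<dots> = poly S (r + of_nat l * of_nat E)" using E unfolding coeffs_along_def S_def by blast
    finally show ?thesis by (simp add: T_def poly_monom poly_pcompose)
  qed
  then have "lead_coeff T \<ge> 0" by (rule lead_coeff_nonneg)
  ultimately show False by simp
qed

section \<open>Piecewise polynomiality\<close>

text \<open>\<open>r \<beta> b\<close> moves through no integer between breakpoints, so each inequality
  \<open>a \<bullet> x \<le> r \<beta>\<close> keeps its lattice solutions, and so does its shift by a period.\<close>

lemma lattice_points_dilate_constant:
  fixes P :: "(real ^ 'n) set"
  assumes P: "rational_polytope P"
  shows "\<exists>B d. B \<subseteq> {0..} \<and> (\<forall>M. finite (B \<inter> {..M})) \<and> d > 0 \<and>
    (\<forall>lo hi r s l. 0 \<le> lo \<longrightarrow> {lo<..<hi} \<inter> B = {} \<longrightarrow> r \<in> {lo<..<hi} \<longrightarrow> s \<in> {lo<..<hi} \<longrightarrow>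
      lattice_points (dilate (real_of_rat (r + of_nat (l * d))) P) \<subseteq>
      lattice_points (dilate (real_of_rat (s + of_nat (l * d))) P))"
proof -
  obtain H where H: "finite H" "\<And>a \<beta>. (a, \<beta>) \<in> H \<Longrightarrow> rational_vector a \<and> \<beta> \<in> \<rat>"
    and P_eq: "P = {x. \<forall>(a, \<beta>)\<in>H. a \<bullet> x \<le> \<beta>}"
    using rational_polytope_halfspaces[OF P] by blast
  have "\<And>a. a \<in> fst ` H \<Longrightarrow> rational_vector a" "rational_vector (0 :: real ^ 'n)"
    using H(2) by (auto simp: rational_vector_vec)
  from shifted_lattice_inner_denominator[OF finite_imageI[OF H(1)] this]
  obtain b :: nat where "b > 0 \<and> (\<forall>a\<in>fst ` H. \<forall>x\<in>shifted_lattice 0. real b * (a \<bullet> x) \<in> \<int>)"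
    by (rule exE)
  then have b: "b > 0" "\<And>a \<beta> x. (a, \<beta>) \<in> H \<Longrightarrow> x \<in> shifted_lattice 0 \<Longrightarrow> real b * (a \<bullet> x) \<in> \<int>"
    by force+
  define \<Gamma> where "\<Gamma> = (\<lambda>(a, \<beta>). real b * \<beta>) ` H"
  have \<Gamma>: "finite \<Gamma>" "\<Gamma> \<subseteq> \<rat>" using H by (auto simp: \<Gamma>_def)
  obtain d :: nat where d: "d > 0" "\<And>\<gamma>. \<gamma> \<in> \<Gamma> \<Longrightarrow> real d * \<gamma> \<in> \<int>"
    using common_denominator[OF \<Gamma>] by blast
  \<comment> \<open>Excluding \<open>\<gamma> = 0\<close> keeps the set discrete: that product is
    the integer 0 for every \<open>r\<close>.\<close>
  define B where "B = {r. r \<ge> 0 \<and> (\<exists>\<gamma>\<in>\<Gamma>. \<gamma> \<noteq> 0 \<and> real_of_rat r * \<gamma> \<in> \<int>)}"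
  have "finite (B \<inter> {..M})" for M
  proof -
    have "finite {r. 0 \<le> r \<and> r \<le> M \<and> real_of_rat r * \<gamma> \<in> \<int>}" (is "finite ?R") if "\<gamma> \<noteq> 0" for \<gamma>
    proof (rule inj_on_finite)
      show "inj_on (\<lambda>r. real_of_rat r * \<gamma>) ?R" using that by (auto simp: inj_on_def)
      show "(\<lambda>r. real_of_rat r * \<gamma>) ` ?R \<subseteq> {z \<in> \<int>. \<bar>z\<bar> \<le> real_of_rat M * \<bar>\<gamma>\<bar>}"
        by (auto simp: abs_mult of_rat_less_eq intro!: mult_right_mono)
      show "finite {z \<in> \<int>. \<bar>z\<bar> \<le> real_of_rat M * \<bar>\<gamma>\<bar>}" by (rule finite_abs_int_segment)
    qed
    then have "finite (\<Union>\<gamma>\<in>{\<gamma>\<in>\<Gamma>. \<gamma> \<noteq> 0}. {r. 0 \<le> r \<and> r \<le> M \<and> real_of_rat r * \<gamma> \<in> \<int>})"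
      using \<Gamma>(1) by auto
    then show ?thesis by (rule rev_finite_subset) (auto simp: B_def)
  qed
  moreover have "lattice_points (dilate (real_of_rat (r + of_nat (l * d))) P) \<subseteq>
      lattice_points (dilate (real_of_rat (s + of_nat (l * d))) P)"
    if lo: "0 \<le> lo" and I: "{lo<..<hi} \<inter> B = {}" and r: "r \<in> {lo<..<hi}" and s: "s \<in> {lo<..<hi}"
    for lo hi r s l
  proof
    have pos: "real_of_rat (r + of_nat (l * d)) > 0" "real_of_rat (s + of_nat (l * d)) > 0"
      using lo r s by (auto simp: add_pos_nonneg)
    have mem: "x \<in> dilate c P \<longleftrightarrow> (\<forall>(a, \<beta>)\<in>H. a \<bullet> x \<le> c * \<beta>)" if "c > 0" for c x
      unfolding mem_dilate_pos[OF that] using that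
      by (simp add: P_eq pos_divide_le_eq mult.commute split_def)
    fix x assume x: "x \<in> lattice_points (dilate (real_of_rat (r + of_nat (l * d))) P)"
    have "a \<bullet> x \<le> real_of_rat (s + of_nat (l * d)) * \<beta>" if h: "(a, \<beta>) \<in> H" for a \<beta>
    proof (rule ccontr)
      assume viol: "\<not> a \<bullet> x \<le> real_of_rat (s + of_nat (l * d)) * \<beta>"
      define \<gamma> where "\<gamma> = real b * \<beta>"
      have \<gamma>: "\<gamma> \<in> \<Gamma>" using h by (force simp: \<Gamma>_def \<gamma>_def)
      \<comment> \<open>Subtracting the contribution of the \<open>l\<close> periods, an integer by
        the choice of \<open>d\<close>, reduces the comparison to the factors \<open>r\<close> and
        \<open>s\<close> themselves.\<close>
      define w where "w = real b * (a \<bullet> x) - real l * (real d * \<gamma>)"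
      have "w \<in> \<int>"
        unfolding w_def using b(2)[OF h] x d(2)[OF \<gamma>]
        by (intro Ints_diff Ints_mult[of "real l"]) (auto simp: lattice_points_shifted)
      have "a \<bullet> x \<le> real_of_rat (r + of_nat (l * d)) * \<beta>"
        using x h mem[OF pos(1), of x] by (auto simp: lattice_points_def)
      then have "real b * (a \<bullet> x) \<le> real b * (real_of_rat (r + of_nat (l * d)) * \<beta>)"
        by (intro mult_left_mono) auto
      then have w_le: "w \<le> real_of_rat r * \<gamma>"
        by (simp add: w_def \<gamma>_def of_rat_add of_rat_mult algebra_simps)
      have "real b * (a \<bullet> x) > real b * (real_of_rat (s + of_nat (l * d)) * \<beta>)"
        using viol b(1) by (intro mult_strict_left_mono) auto
      then have w_gt: "w > real_of_rat s * \<gamma>"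
        by (simp add: w_def \<gamma>_def of_rat_add of_rat_mult algebra_simps)
      have "\<gamma> \<noteq> 0" using w_le w_gt by auto
      obtain g where g: "\<gamma> = real_of_rat g" using \<gamma> \<Gamma>(2) by (auto elim: Rats_cases)
      obtain z where z: "w = of_int z" using \<open>w \<in> \<int>\<close> by (elim Ints_cases)
      \<comment> \<open>The factor at which the moving right-hand side equals the integer
        \<open>w\<close>. It lies between \<open>s\<close> and \<open>r\<close>, in an order given
        by the sign of \<open>g\<close>, and is thus a breakpoint inside the interval.\<close>
      define \<rho> where "\<rho> = of_int z / g"
      have \<rho>: "real_of_rat \<rho> * \<gamma> = w"
        using \<open>\<gamma> \<noteq> 0\<close> by (simp add: \<rho>_def g z of_rat_divide)
      have le: "\<rho> * g \<le> r * g" "s * g < \<rho> * g"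
        using w_le w_gt unfolding \<rho>[symmetric] g by (simp_all add: of_rat_mult[symmetric] of_rat_less_eq of_rat_less)
      have "\<rho> \<in> {lo<..<hi}"
        using le r s by (cases "g > 0") (auto simp: mult_le_cancel_right mult_less_cancel_right)
      moreover have "\<rho> \<in> B" unfolding B_def
        using calculation lo \<gamma> \<open>\<gamma> \<noteq> 0\<close> \<rho> \<open>w \<in> \<int>\<close> by auto
      ultimately show False using I by blast
    qed
    then have "x \<in> dilate (real_of_rat (s + of_nat (l * d))) P" unfolding mem[OF pos(2)] by blast
    with x show "x \<in> lattice_points (dilate (real_of_rat (s + of_nat (l * d))) P)"
      by (simp add: lattice_points_def)
  qed
  ultimately show ?thesis using d(1) by (intro exI[of _ B] exI[of _ d]) (auto simp: B_def)
qed

text \<open>If the counts along \<open>r + lD\<close> and \<open>s + lD\<close> agree, then the two polynomials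
  with coefficients at \<open>r\<close> and at \<open>s\<close> are translates of each other.\<close>

lemma coeffs_along_shift:
  fixes P :: "(real ^ 'n) set"
  assumes "coeffs_along P D r q" "coeffs_along P D s q'" "i \<le> CARD('n)"
    and "\<And>l. lattice_points (dilate (real_of_rat (r + of_nat (l * D))) P) =
      lattice_points (dilate (real_of_rat (s + of_nat (l * D))) P)"
  shows "q i = (\<Sum>j\<in>{i..CARD('n)}. q' j * of_nat (j choose i) * (s - r) ^ (j - i))"
proof -
  let ?n = "CARD('n)"
  \<comment> \<open>\<open>?S\<close> is the polynomial for \<open>s\<close> with
    \<open>x + (s - r)\<close> as its argument, which turns r + lD into s + lD.\<close>
  let ?R = "\<Sum>j\<le>?n. monom (q j) j" and ?S = "\<Sum>j\<le>?n. smult (q' j) ([:s - r, 1:] ^ j)"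
  have "?R = ?S"
  proof (rule poly_eqI_of_nat)
    show "of_nat D \<noteq> (0::rat)" using assms(1) by (simp add: coeffs_along_def)
    fix l
    have "poly ?R (r + of_nat l * of_nat D) = poly (\<Sum>j\<le>?n. monom (q' j) j) (s + of_nat l * of_nat D)"
      using assms(1,2) assms(4)[of l] unfolding coeffs_along_def of_nat_mult by metis
    also have "\<dots> = poly ?S (r + of_nat l * of_nat D)"
      unfolding poly_monom_sum by (simp add: poly_sum)
    finally show "poly ?R (r + of_nat l * of_nat D) = poly ?S (r + of_nat l * of_nat D)" .
  qed
  then have "q i = coeff ?S i" using assms(3) coeff_monom_sum[of q ?n i] by simp
  also have "\<dots> = (\<Sum>j\<le>?n. q' j * coeff ([:s - r, 1:] ^ j) i)" by (simp add: coeff_sum)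
  also have "\<dots> = (\<Sum>j\<in>{i..?n}. q' j * coeff ([:s - r, 1:] ^ j) i)"
  proof (rule sum.mono_neutral_right)
    show "\<forall>j\<in>{..?n} - {i..?n}. q' j * coeff ([:s - r, 1:] ^ j) i = 0"
      by (auto intro!: coeff_eq_0 simp: degree_linear_power)
  qed auto
  also have "\<dots> = (\<Sum>j\<in>{i..?n}. q' j * of_nat (j choose i) * (s - r) ^ (j - i))"
    by (intro sum.cong) (simp_all add: coeff_linear_poly_power)
  finally show ?thesis .
qed

theorem theorem1p6:
  fixes P :: "(real ^ 'n) set" and i :: nat
  assumes "rational_polytope P"
    and "aff_dim P = int CARD('n)"
    and "i \<le> CARD('n)"
  shows "piecewise_polynomial (CARD('n) - i) (rational_ehrhart_coeff P i)"
proof -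
  let ?n = "CARD('n)" and ?Q = "rational_ehrhart_coeff P"
  obtain B d where B: "B \<subseteq> {0..}" "\<forall>M. finite (B \<inter> {..M})" and "d > 0"
    and const: "\<And>lo hi r s l. 0 \<le> lo \<Longrightarrow> {lo<..<hi} \<inter> B = {} \<Longrightarrow> r \<in> {lo<..<hi} \<Longrightarrow>
      s \<in> {lo<..<hi} \<Longrightarrow> lattice_points (dilate (real_of_rat (r + of_nat (l * d))) P) \<subseteq>
        lattice_points (dilate (real_of_rat (s + of_nat (l * d))) P)"
    using lattice_points_dilate_constant[OF assms(1)] by blast
  have "\<exists>p. degree p = ?n - i \<and> (\<forall>r\<in>{lo<..<hi}. ?Q i r = poly p r)"
    if lo: "0 \<le> lo" "lo < hi" and I: "{lo<..<hi} \<inter> B = {}" for lo hi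
  proof -
    \<comment> \<open>Any base point in the interval would do. It is fixed before \<open>r\<close>,
      so one polynomial serves all \<open>r\<close>.\<close>
    define s where "s = (lo + hi) / 2"
    have s: "s \<in> {lo<..<hi}" "s \<ge> 0" using lo by (auto simp: s_def)
    obtain D where D: "coeffs_along P D s (\<lambda>j. ?Q j s)"
      using rational_ehrhart_coeff_along[OF assms(1) s(2)] by blast
    define c where "c j = ?Q j s * of_nat (j choose i)" for j
    \<comment> \<open>The formula of \<open>coeffs_along_shift\<close> read as a polynomial in
      \<open>r\<close>; \<open>[:s, -1:]\<close> is s - r.\<close>
    define p where "p = (\<Sum>j\<in>{i..?n}. smult (c j) ([:s, -1:] ^ (j - i)))"
    have "c ?n \<noteq> 0"
      using coeffs_along_leading[OF assms(1,2) D s(2)] assms(3) by (simp add: c_def)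
    have "degree p \<le> ?n - i" unfolding p_def
    proof (rule degree_sum_le)
      fix j assume "j \<in> {i..?n}"
      then show "degree (smult (c j) ([:s, -1:] ^ (j - i))) \<le> ?n - i"
        by (intro order_trans[OF degree_smult_le]) (auto intro: diff_le_mono)
    qed simp
    moreover have "coeff p (?n - i) = c ?n * (-1) ^ (?n - i)"
    proof -
      have "coeff p (?n - i) = (\<Sum>j\<in>{i..?n}. c j * coeff ([:s, -1:] ^ (j - i)) (?n - i))"
        by (simp add: p_def coeff_sum)
      \<comment> \<open>Only \<open>j = n\<close> reaches the degree n - i; its coefficient is
        nonzero because the leading Ehrhart coefficient at \<open>s\<close> is.\<close>
      also have "\<dots> = (\<Sum>j\<in>{?n}. c j * coeff ([:s, -1:] ^ (j - i)) (?n - i))"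
        using assms(3) by (intro sum.mono_neutral_right) (auto intro!: coeff_eq_0)
      finally show ?thesis by simp
    qed
    then have "?n - i \<le> degree p" using \<open>c ?n \<noteq> 0\<close> by (intro le_degree) simp
    ultimately have "degree p = ?n - i" by simp
    moreover have "?Q i r = poly p r" if r: "r \<in> {lo<..<hi}" for r
    proof -
      obtain E where E: "coeffs_along P E r (\<lambda>j. ?Q j r)"
        using rational_ehrhart_coeff_along[OF assms(1), of r] lo r by auto
      have "D > 0" "E > 0" using D E by (auto simp: coeffs_along_def)
      \<comment> \<open>One difference for all purposes: a multiple of \<open>D\<close> for the
        coefficients at \<open>s\<close>, of \<open>E\<close> for those at \<open>r\<close>, and of
        \<open>d\<close> for the equality of the lattice point sets.\<close>
      have "coeffs_along P (D * E * d) r (\<lambda>j. ?Q j r)" "coeffs_along P (D * E * d) s (\<lambda>j. ?Q j s)"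
        using coeffs_along_mult[OF E, of "D * d"] coeffs_along_mult[OF D, of "E * d"]
          \<open>D > 0\<close> \<open>E > 0\<close> \<open>d > 0\<close> by (simp_all add: mult_ac)
      moreover have "lattice_points (dilate (real_of_rat (r + of_nat (l * (D * E * d)))) P) =
          lattice_points (dilate (real_of_rat (s + of_nat (l * (D * E * d)))) P)" for l
        using const[OF lo(1) I r s(1), of "l * (D * E)"] const[OF lo(1) I s(1) r, of "l * (D * E)"]
        by (simp only: mult.assoc)
      ultimately have "?Q i r = (\<Sum>j\<in>{i..?n}. ?Q j s * of_nat (j choose i) * (s - r) ^ (j - i))"
        by (rule coeffs_along_shift[OF _ _ assms(3)])
      also have "\<dots> = poly p r" by (simp add: p_def c_def poly_sum)
      finally show ?thesis .
    qed
    ultimately show ?thesis by blast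
  qed
  then show ?thesis
    unfolding piecewise_polynomial_def by (intro exI[of _ B] conjI B allI impI) simp
qed

end
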